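(* For $t\in\mathbb{N}$ with $t\ge2$, the underlying treewidth of the class of $K_t$-topological-minor-free graphs equals $t-2$ if $t\in\{2,3,4\}$ and equals $t$ if $t\ge5$.
   Context: Graphs are finite, simple and undirected; $\mathrm{tw}$ denotes treewidth. A graph is $K_t$-topological-minor-free if it has no subgraph isomorphic to a subdivision of $K_t$. For graphs $G,H$, an $H$-partition of $G$ is a partition $(V_x : x\in V(H))$ of $V(G)$ such that for every edge $vw$ of $G$ with $v\in V_x$, $w\in V_y$, either $x=y$ or $xy\in E(H)$; its width is $\max_x|V_x|$. $\mathrm{tpw}_c(G)$ is the minimum width of an $H$-partition of $G$ over all graphs $H$ with $\mathrm{tw}(H)\le c$. The underlying treewidth of a graph class $\mathcal{G}$ is the minimum $c\in\mathbb{N}_0$ for which there is a function $f$ with $\mathrm{tpw}_c(G)\le f(\mathrm{tw}(G))$ for all $G\in\mathcal{G}$ (unbounded if no such $c$ exists). *)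

theory Defs
  imports Main
begin

text \<open>Finite simple graphs are represented by a vertex set V and an edge set E,
  each edge being a 2-element subset of V. Vertices are natural numbers
  (every finite graph is isomorphic to such a graph).\<close>

definition graph :: "nat set \<Rightarrow> nat set set \<Rightarrow> bool" where
  "graph V E \<longleftrightarrow> finite V \<and> (\<forall>e\<in>E. \<exists>u v. e = {u, v} \<and> u \<noteq> v \<and> u \<in> V \<and> v \<in> V)"

definition connected_on :: "nat set \<Rightarrow> nat set set \<Rightarrow> bool" where
  "connected_on S E \<longleftrightarrow>
     (\<forall>u\<in>S. \<forall>v\<in>S. (\<lambda>x y. {x, y} \<in> E \<and> x \<in> S \<and> y \<in> S)\<^sup>*\<^sup>* u v)"

definition is_cycle :: "nat set set \<Rightarrow> nat list \<Rightarrow> bool" where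
  "is_cycle E cs \<longleftrightarrow> length cs \<ge> 3 \<and> distinct cs
     \<and> (\<forall>k. Suc k < length cs \<longrightarrow> {cs ! k, cs ! Suc k} \<in> E)
     \<and> {last cs, hd cs} \<in> E"

definition is_tree :: "nat set \<Rightarrow> nat set set \<Rightarrow> bool" where
  "is_tree V E \<longleftrightarrow> graph V E \<and> V \<noteq> {} \<and> connected_on V E \<and> \<not> (\<exists>cs. is_cycle E cs)"

definition tree_decomp_width_le ::
    "nat set \<Rightarrow> nat set set \<Rightarrow> nat \<Rightarrow> nat set \<Rightarrow> nat set set \<Rightarrow> (nat \<Rightarrow> nat set) \<Rightarrow> bool" where
  "tree_decomp_width_le V E k TV TE bag \<longleftrightarrow>
     is_tree TV TE
     \<and> (\<forall>x\<in>TV. bag x \<subseteq> V)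
     \<and> (\<forall>v\<in>V. \<exists>x\<in>TV. v \<in> bag x)
     \<and> (\<forall>e\<in>E. \<exists>x\<in>TV. e \<subseteq> bag x)
     \<and> (\<forall>v\<in>V. connected_on {x\<in>TV. v \<in> bag x} TE)
     \<and> (\<forall>x\<in>TV. card (bag x) \<le> k + 1)"

definition treewidth :: "nat set \<Rightarrow> nat set set \<Rightarrow> nat" where
  "treewidth V E = (LEAST k. \<exists>TV TE bag. tree_decomp_width_le V E k TV TE bag)"

text \<open>An H-partition of G given by the map p (V_x = p^{-1}(x) \<inter> V(G)), of width at most w.\<close>
definition H_partition_width_le ::
    "nat set \<Rightarrow> nat set set \<Rightarrow> nat set \<Rightarrow> nat set set \<Rightarrow> (nat \<Rightarrow> nat) \<Rightarrow> nat \<Rightarrow> bool" where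
  "H_partition_width_le V E VH EH p w \<longleftrightarrow>
     (\<forall>v\<in>V. p v \<in> VH)
     \<and> (\<forall>v w'. {v, w'} \<in> E \<longrightarrow> p v = p w' \<or> {p v, p w'} \<in> EH)
     \<and> (\<forall>x\<in>VH. card {v\<in>V. p v = x} \<le> w)"

definition tpw :: "nat \<Rightarrow> nat set \<Rightarrow> nat set set \<Rightarrow> nat" where
  "tpw c V E = (LEAST w. \<exists>VH EH p. graph VH EH \<and> treewidth VH EH \<le> c
                              \<and> H_partition_width_le V E VH EH p w)"

definition tpw_bounded_by_tw :: "(nat set \<times> nat set set) set \<Rightarrow> nat \<Rightarrow> bool" where
  "tpw_bounded_by_tw \<G> c \<longleftrightarrow>
     (\<exists>f :: nat \<Rightarrow> nat. \<forall>(V, E)\<in>\<G>. tpw c V E \<le> f (treewidth V E))"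

definition underlying_treewidth_eq :: "(nat set \<times> nat set set) set \<Rightarrow> nat \<Rightarrow> bool" where
  "underlying_treewidth_eq \<G> c \<longleftrightarrow>
     tpw_bounded_by_tw \<G> c \<and> (\<forall>c' < c. \<not> tpw_bounded_by_tw \<G> c')"

definition has_Kt_top_minor :: "nat \<Rightarrow> nat set \<Rightarrow> nat set set \<Rightarrow> bool" where
  "has_Kt_top_minor t V E \<longleftrightarrow>
     (\<exists>(b :: nat \<Rightarrow> nat) (P :: nat \<Rightarrow> nat \<Rightarrow> nat list).
        inj_on b {..<t} \<and> b ` {..<t} \<subseteq> V
        \<and> (\<forall>i j. i < j \<and> j < t \<longrightarrow>
              length (P i j) \<ge> 2 \<and> distinct (P i j)
              \<and> hd (P i j) = b i \<and> last (P i j) = b j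
              \<and> (\<forall>k. Suc k < length (P i j) \<longrightarrow> {P i j ! k, P i j ! Suc k} \<in> E)
              \<and> set (butlast (tl (P i j))) \<inter> b ` {..<t} = {})
        \<and> (\<forall>i j i' j'. i < j \<and> j < t \<and> i' < j' \<and> j' < t \<and> (i, j) \<noteq> (i', j') \<longrightarrow>
              set (butlast (tl (P i j))) \<inter> set (butlast (tl (P i' j'))) = {}))"

definition Kt_top_minor_free_class :: "nat \<Rightarrow> (nat set \<times> nat set set) set" where
  "Kt_top_minor_free_class t = {(V, E). graph V E \<and> \<not> has_Kt_top_minor t V E}"

end

theory Submission
  imports Defs "HOL-Library.Nat_Bijection" "HOL-Library.Sublist"
begin

text \<open>Upper bound. Say that \<open>G\<close> has a \<open>(c, b)\<close>-bundle if some connected set contains \<open>b\<close> disjoint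
  connected pieces, each adjacent to every one of \<open>c\<close> vertices outside the set. A bundle with
  \<open>c = t\<close>, \<open>b = t\<^sup>2\<close> yields a subdivided \<open>K\<^sub>t\<close> with the \<open>t\<close> outside vertices as branch vertices; for
  \<open>t \<le> 4\<close> the connectedness of the ambient set makes already \<open>c = t - 2\<close> with \<open>b \<le> 3\<close> sufficient.
  Without bundles an \<open>H\<close>-partition is built greedily: a component \<open>X\<close> of the rest sees few vertices
  in at most \<open>c\<close> earlier parts, which form a clique. By the Erdos--Posa property in bounded
  treewidth a bounded set meets all connected subsets of \<open>X\<close> that see all \<open>c\<close> parts. Closing it under
  lowest common ancestors in the tree decomposition makes every remaining component see
  at most \<open>2 k + 2\<close> vertices again, so the bound on the part size does not deteriorate.

  Lower bound. Take all ancestor pairs of an \<open>n\<close>-ary tree of depth \<open>d\<close>, and attach the vertices of a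
  long path in cyclic order to the \<open>d\<close> ancestors of each leaf. The treewidth is at most
  \<open>d + 1\<close>, whereas every \<open>H\<close>-partition of small width separates the vertices of some branch and many
  path segments, which gives a complete minor on \<open>d + 2\<close> vertices in \<open>H\<close>. For \<open>t = d + 3\<close> a \<open>K\<^sub>t\<close>-subdivision is
  excluded by treewidth. For \<open>t = d + 1 \<ge> 5\<close> path vertices have too small degree to be branch vertices,
  and two incomparable tree vertices are separated by fewer than \<open>t - 1\<close> vertices.\<close>

section \<open>Reachability and rooted trees\<close>

lemma ex_max_nat:
  fixes f :: "'a \<Rightarrow> nat"
  assumes "finite A" "A \<noteq> {}"
  obtains x where "x \<in> A" "\<And>y. y \<in> A \<Longrightarrow> f y \<le> f x"
proof -
  have "Max (f ` A) \<in> f ` A" using assms by simp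
  then obtain x where "x \<in> A" "Max (f ` A) = f x" by blast
  then show ?thesis using assms by (metis Max_ge finite_imageI imageI that)
qed

lemma graph_edgeE:
  assumes "graph V E" "e \<in> E"
  obtains u v where "e = {u, v}" "u \<noteq> v" "u \<in> V" "v \<in> V"
proof -
  have "\<exists>u v. e = {u, v} \<and> u \<noteq> v \<and> u \<in> V \<and> v \<in> V"
    using assms by (simp add: graph_def)
  then show ?thesis using that by blast
qed

lemma graph_edge:
  assumes "graph V E" "{u, v} \<in> E"
  shows "u \<noteq> v" "u \<in> V" "v \<in> V"
  using graph_edgeE[OF assms] by (metis doubleton_eq_iff)+

text \<open>\<open>reach S E u u\<close> holds even for \<open>u\<close> outside \<open>S\<close>;
  only the steps are confined to \<open>S\<close>. Hence the extra premise \<open>u \<in> S\<close>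
  in \<open>reach_path\<close>.\<close>

definition reach :: "nat set \<Rightarrow> nat set set \<Rightarrow> nat \<Rightarrow> nat \<Rightarrow> bool" where
  "reach S E = (\<lambda>x y. {x, y} \<in> E \<and> x \<in> S \<and> y \<in> S)\<^sup>*\<^sup>*"

lemma connected_on_reach: "connected_on S E \<longleftrightarrow> (\<forall>u\<in>S. \<forall>v\<in>S. reach S E u v)"
  by (simp add: connected_on_def reach_def)

lemma reach_refl [simp]: "reach S E u u"
  by (simp add: reach_def)

lemma reach_edge: "{u, v} \<in> E \<Longrightarrow> u \<in> S \<Longrightarrow> v \<in> S \<Longrightarrow> reach S E u v"
  by (auto simp: reach_def)

lemma reach_trans: "reach S E u v \<Longrightarrow> reach S E v w \<Longrightarrow> reach S E u w"
  unfolding reach_def by (rule rtranclp_trans)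

lemma reach_sym: "reach S E u v \<Longrightarrow> reach S E v u"
proof -
  have "symp (\<lambda>x y. {x, y} \<in> E \<and> x \<in> S \<and> y \<in> S)"
    by (auto simp: symp_def insert_commute)
  then show "reach S E u v \<Longrightarrow> reach S E v u"
    unfolding reach_def by (rule sympD[OF symp_rtranclp])
qed

lemma reach_mono: "reach S E u v \<Longrightarrow> S \<subseteq> S' \<Longrightarrow> E \<subseteq> E' \<Longrightarrow> reach S' E' u v"
  unfolding reach_def by (rule rtranclp_mono[THEN predicate2D, rotated]) auto

lemma reach_closed:
  assumes "reach S E u v" "u \<in> U"
    and "\<And>x y. x \<in> U \<Longrightarrow> x \<in> S \<Longrightarrow> y \<in> S \<Longrightarrow> {x, y} \<in> E \<Longrightarrow> y \<in> U"
  shows "v \<in> U"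
  using assms(1,2) unfolding reach_def
  by (induction rule: rtranclp_induct) (auto intro: assms(3))

lemma reach_in: "reach S E u v \<Longrightarrow> u \<in> S \<Longrightarrow> v \<in> S"
  by (rule reach_closed)

lemma reach_crossing:
  assumes "reach S E u v" "u \<in> U" "v \<notin> U"
  obtains x y where "x \<in> U" "y \<notin> U" "x \<in> S" "y \<in> S" "{x, y} \<in> E"
  using reach_closed[OF assms(1,2)] assms(3) by blast

lemma reach_first_step:
  assumes "reach S E u v" "u \<noteq> v"
  obtains y where "{u, y} \<in> E" "u \<in> S" "y \<in> S" "reach S E y v"
  using assms(1) unfolding reach_def
proof (cases rule: converse_rtranclpE)
  case (step y)
  then show ?thesis using that by (auto simp: reach_def)
qed (use assms in simp)

text \<open>Every vertex on a walk from \<open>x\<close> is itself reached from \<open>x\<close>, so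
  the walk stays inside the component.\<close>

lemma connected_on_component: "connected_on {z. reach S E x z} E"
proof -
  have "reach {z. reach S E x z} E x z" if "reach S E x z" for z
    using that unfolding reach_def
  proof (induction rule: rtranclp_induct)
    case (step y z)
    then have "reach S E x y" "reach S E x z"
      by (auto simp: reach_def intro: rtranclp.rtrancl_into_rtrancl)
    then show ?case using step by (auto intro: rtranclp.rtrancl_into_rtrancl)
  qed simp
  then show ?thesis
    unfolding connected_on_reach by (blast intro: reach_trans reach_sym)
qed

definition walk :: "nat set set \<Rightarrow> nat list \<Rightarrow> bool" where
  "walk E = successively (\<lambda>x y. {x, y} \<in> E)"

lemma walk_nth: "walk E xs \<longleftrightarrow> (\<forall>k. Suc k < length xs \<longrightarrow> {xs ! k, xs ! Suc k} \<in> E)"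
  by (auto simp: walk_def successively_conv_nth)

lemma reach_path:
  assumes "reach S E u v" "u \<in> S"
  obtains xs where "xs \<noteq> []" "distinct xs" "hd xs = u" "last xs = v" "walk E xs" "set xs \<subseteq> S"
proof -
  have "u \<in> S \<longrightarrow> (\<exists>xs. xs \<noteq> [] \<and> distinct xs \<and> hd xs = u \<and> last xs = v \<and> walk E xs \<and> set xs \<subseteq> S)"
    using assms(1) unfolding reach_def
  proof (induction rule: converse_rtranclp_induct)
    case base
    show ?case by (auto intro!: exI[of _ "[v]"] simp: walk_def)
  next
    case (step y z)
    then obtain xs where xs: "xs \<noteq> []" "distinct xs" "hd xs = z" "last xs = v" "walk E xs" "set xs \<subseteq> S"
      by auto
    show ?case
    \<comment> \<open>If \<open>y\<close> already lies on the path, its suffix from \<open>y\<close>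
      on is kept, so no vertex is repeated.\<close>
    proof (cases "y \<in> set xs")
      case True
      then obtain as bs where "xs = as @ y # bs" by (meson split_list)
      then show ?thesis using xs
        by (intro impI exI[of _ "y # bs"]) (auto simp: walk_def successively_append_iff)
    next
      case False
      then show ?thesis using xs step
        by (intro impI exI[of _ "y # xs"]) (auto simp: walk_def successively_Cons)
    qed
  qed
  then show ?thesis using that assms(2) by blast
qed

lemma walk_reach:
  assumes "walk E xs" "xs \<noteq> []"
  shows "reach (set xs) E (hd xs) (last xs)"
  using assms
proof (induction xs)
  case (Cons x xs)
  show ?case
  proof (cases "xs = []")
    case False
    then have "{x, hd xs} \<in> E" "walk E xs"
      using Cons.prems by (auto simp: walk_def successively_Cons)
    then have "reach (set (x # xs)) E x (hd xs)" "reach (set (x # xs)) E (hd xs) (last xs)"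
      using Cons.IH False by (auto intro: reach_edge reach_mono)
    then show ?thesis using False by (auto intro: reach_trans)
  qed simp
qed simp

section \<open>Rooted trees given by a parent map\<close>

definition tree_edges :: "nat set \<Rightarrow> nat \<Rightarrow> (nat \<Rightarrow> nat) \<Rightarrow> nat set set" where
  "tree_edges T r par = {{x, par x} | x. x \<in> T \<and> x \<noteq> r}"

text \<open>The rank need not be the depth: anything that decreases from child to parent serves, be
  it a distance from the root or an elimination order.\<close>

locale rooted_tree =
  fixes T :: "nat set" and r :: nat and par :: "nat \<Rightarrow> nat" and rk :: "nat \<Rightarrow> nat"
  assumes finite_T: "finite T" and root_in: "r \<in> T"
    and par_in: "x \<in> T \<Longrightarrow> x \<noteq> r \<Longrightarrow> par x \<in> T"
    and rk_par: "x \<in> T \<Longrightarrow> x \<noteq> r \<Longrightarrow> rk (par x) < rk x"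
begin

lemma edge_cases:
  assumes "{x, y} \<in> tree_edges T r par"
  obtains "x \<in> T" "x \<noteq> r" "y = par x" | "y \<in> T" "y \<noteq> r" "x = par y"
  using assms by (auto simp: tree_edges_def doubleton_eq_iff)

lemma reach_root: "x \<in> T \<Longrightarrow> reach T (tree_edges T r par) x r"
proof (induction "rk x" arbitrary: x rule: less_induct)
  case less
  show ?case
  proof (cases "x = r")
    case False
    then have "reach T (tree_edges T r par) (par x) r"
      using less par_in rk_par by blast
    moreover have "reach T (tree_edges T r par) x (par x)"
      using False less.prems par_in by (auto intro!: reach_edge simp: tree_edges_def)
    ultimately show ?thesis by (blast intro: reach_trans)
  qed simp
qed

text \<open>At a vertex of maximum rank on a cycle no cycle neighbour is a child, so both neighbours
  equal the parent although they are distinct.\<close>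

lemma acyclic: "\<not> is_cycle (tree_edges T r par) cs"
proof
  assume "is_cycle (tree_edges T r par) cs"
  then have len: "length cs \<ge> 3" and dist: "distinct cs"
    and step: "\<And>k. Suc k < length cs \<Longrightarrow> {cs ! k, cs ! Suc k} \<in> tree_edges T r par"
    and close: "{last cs, hd cs} \<in> tree_edges T r par"
    by (auto simp: is_cycle_def)
  define n where "n = length cs"
  have cl: "{cs ! (n - 1), cs ! 0} \<in> tree_edges T r par"
    using close len by (metis n_def hd_conv_nth last_conv_nth list.size(3) not_numeral_le_zero)
  have "0 \<in> {..<n}" using len by (cases cs) (auto simp: n_def)
  then obtain i where "i \<in> {..<n}" "\<And>j. j \<in> {..<n} \<Longrightarrow> rk (cs ! j) \<le> rk (cs ! i)"
    using ex_max_nat[of "{..<n}" "\<lambda>i. rk (cs ! i)"] by blast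
  then have i: "i < n" "\<And>j. j < n \<Longrightarrow> rk (cs ! j) \<le> rk (cs ! i)" by auto
  have nbr: "cs ! j = par (cs ! i)" if "{cs ! i, cs ! j} \<in> tree_edges T r par" "j < n" for j
    using that(1)
  proof (cases rule: edge_cases)
    case 2
    then show ?thesis using i(2)[OF that(2)] rk_par by fastforce
  qed simp
  define a where "a = (if i = 0 then n - 1 else i - 1)"
  define b where "b = (if i = n - 1 then 0 else Suc i)"
  have ab: "a < n" "b < n" "a \<noteq> b" using i len by (auto simp: a_def b_def n_def)
  have "{cs ! i, cs ! a} \<in> tree_edges T r par"
    using step[of "i - 1"] i cl by (cases "i = 0") (auto simp: a_def n_def insert_commute)
  moreover have "{cs ! i, cs ! b} \<in> tree_edges T r par"
    using step[of i] i cl by (auto simp: b_def n_def)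
  ultimately have "cs ! a = cs ! b" using nbr ab by metis
  then show False using ab dist by (simp add: n_def nth_eq_iff_index_eq)
qed

lemma is_tree: "is_tree T (tree_edges T r par)"
proof -
  have "graph T (tree_edges T r par)"
    unfolding graph_def tree_edges_def using finite_T par_in rk_par
    by fastforce
  moreover have "connected_on T (tree_edges T r par)"
    unfolding connected_on_reach by (blast intro: reach_root reach_sym reach_trans)
  ultimately show ?thesis using acyclic root_in by (auto simp: is_tree_def)
qed

definition up :: "(nat \<times> nat) set" where
  "up = {(x, par x) | x. x \<in> T \<and> x \<noteq> r}"

text \<open>The ancestor is the first argument, and the relation is reflexive.\<close>

abbreviation anc :: "nat \<Rightarrow> nat \<Rightarrow> bool" where
  "anc y x \<equiv> (x, y) \<in> up\<^sup>*"

lemma anc_rk: "anc y x \<Longrightarrow> x = y \<or> rk y < rk x"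
  by (induction rule: rtrancl_induct) (auto simp: up_def dest: rk_par)

lemma anc_comparable: "anc y x \<Longrightarrow> anc z x \<Longrightarrow> anc y z \<or> anc z y"
  using single_valued_confluent[of up x y z] by (auto simp: single_valued_def up_def)

lemma anc_root: "x \<in> T \<Longrightarrow> anc r x"
proof (induction "rk x" arbitrary: x rule: less_induct)
  case less
  show ?case
  proof (cases "x = r")
    case False
    then have "anc r (par x)" "(x, par x) \<in> up"
      using less par_in rk_par by (auto simp: up_def)
    then show ?thesis by (rule converse_rtrancl_into_rtrancl[rotated])
  qed simp
qed

lemma anc_antisym: "anc x y \<Longrightarrow> anc y x \<Longrightarrow> x = y"
  using anc_rk[of x y] anc_rk[of y x] by auto

lemma anc_in: "anc y x \<Longrightarrow> x \<in> T \<Longrightarrow> y \<in> T"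
  by (induction rule: rtrancl_induct) (auto simp: up_def par_in)

text \<open>The rooted form of a nonempty connected set of tree nodes, with topmost node
  \<open>m\<close>; \<open>connected_subtree\<close> and \<open>subtree_connected\<close> translate
  between the two.\<close>

definition subtree :: "nat set \<Rightarrow> nat \<Rightarrow> bool" where
  "subtree S m \<longleftrightarrow> S \<subseteq> T \<and> m \<in> S \<and> (\<forall>x\<in>S. x \<noteq> m \<longrightarrow> x \<noteq> r \<and> par x \<in> S)"

lemma subtree_anc: "subtree S m \<Longrightarrow> x \<in> S \<Longrightarrow> anc m x"
proof (induction "rk x" arbitrary: x rule: less_induct)
  case less
  show ?case
  proof (cases "x = m")
    case False
    then have "x \<in> T" "x \<noteq> r" "par x \<in> S" using less.prems by (auto simp: subtree_def)
    then have "anc m (par x)" "(x, par x) \<in> up"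
      using less rk_par by (auto simp: up_def)
    then show ?thesis by (rule converse_rtrancl_into_rtrancl[rotated])
  qed simp
qed

text \<open>Climbing from \<open>y\<close> to \<open>z\<close>, no step starts at \<open>m\<close>:
  the parent of \<open>m\<close> has smaller rank than \<open>m\<close> and cannot lie below it. So
  no step leaves \<open>S\<close>.\<close>

lemma subtree_between:
  assumes "subtree S m" "y \<in> S" "anc z y" "anc m z"
  shows "z \<in> S"
  using assms(3,4)
proof (induction rule: rtrancl_induct)
  case (step u z)
  then have u: "z = par u" "u \<in> T" "u \<noteq> r" by (auto simp: up_def)
  have "anc m u" using step by auto
  then have "u \<in> S" using step.IH by simp
  moreover have "u \<noteq> m"
    using anc_rk[OF step.prems] rk_par[OF u(2,3)] u(1) by auto
  ultimately show ?case using assms(1) u by (auto simp: subtree_def)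
qed (use assms in simp)

text \<open>The Helly property in working form. Both tops are ancestors of a common node, hence
  comparable; the ranks put \<open>m'\<close> above \<open>m\<close>, and convexity puts
  \<open>m\<close> into \<open>S'\<close>.\<close>

lemma subtree_meet:
  assumes "subtree S m" "subtree S' m'" "S \<inter> S' \<noteq> {}" "rk m' \<le> rk m"
  shows "m \<in> S'"
proof -
  obtain y where y: "y \<in> S" "y \<in> S'" using assms(3) by auto
  have a: "anc m y" "anc m' y" using subtree_anc y assms by auto
  then have "anc m' m"
    using anc_comparable anc_rk assms(4) by (metis linorder_not_less rtrancl.rtrancl_refl)
  then show ?thesis using subtree_between[OF assms(2) y(2) a(1)] by simp
qed

text \<open>The top is a member of least rank. A walk in \<open>S\<close> to it from another member
  \<open>x\<close> must leave the descendants of \<open>x\<close>, and the only tree edge doing so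
  goes from \<open>x\<close> to its parent.\<close>

lemma connected_subtree:
  assumes "connected_on S (tree_edges T r par)" "S \<noteq> {}" "S \<subseteq> T"
  shows "\<exists>m. subtree S m"
proof -
  obtain m where m: "m \<in> S" "\<And>x. x \<in> S \<Longrightarrow> rk m \<le> rk x"
    using assms(2) ex_has_least_nat[of "\<lambda>x. x \<in> S" _ rk] by blast
  have "x \<noteq> r \<and> par x \<in> S" if x: "x \<in> S" "x \<noteq> m" for x
  proof
    have "anc r m" using anc_root m(1) assms(3) by blast
    then show "x \<noteq> r" using anc_rk[of m r] m(2)[OF x(1)] x by (metis linorder_not_less)
    have "\<not> anc x m" using anc_rk[of m x] m(2)[OF x(1)] x(2) by (metis linorder_not_less)
    moreover have "reach S (tree_edges T r par) x m"
      using assms(1) m x by (auto simp: connected_on_reach)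
    ultimately obtain y z where yz: "anc x y" "\<not> anc x z" "y \<in> S" "z \<in> S"
      "{y, z} \<in> tree_edges T r par"
      using reach_crossing[of S "tree_edges T r par" x m "{y. anc x y}"] by blast
    from yz(5) show "par x \<in> S"
    proof (cases rule: edge_cases)
      case 1
      then have "(y, par y) \<in> up" by (auto simp: up_def)
      have "y = x"
      proof (rule ccontr)
        assume "y \<noteq> x"
        then obtain w where "(y, w) \<in> up" "anc x w"
          using yz(1) by (metis converse_rtranclE)
        then show False using yz(2) 1 by (auto simp: up_def)
      qed
      then show ?thesis using 1 yz by simp
    next
      case 2
      then have "(z, y) \<in> up" by (auto simp: up_def)
      then show ?thesis using yz by (meson converse_rtrancl_into_rtrancl)
    qed
  qed
  then show ?thesis using m assms(3) by (auto simp: subtree_def)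
qed

lemma subtree_connected:
  assumes "subtree S m"
  shows "connected_on S (tree_edges T r par)"
proof -
  have "reach S (tree_edges T r par) x m" if "x \<in> S" for x
    using that
  proof (induction "rk x" arbitrary: x rule: less_induct)
    case less
    show ?case
    proof (cases "x = m")
      case False
      then have x: "x \<in> T" "x \<noteq> r" "par x \<in> S" using less.prems assms by (auto simp: subtree_def)
      then have "reach S (tree_edges T r par) (par x) m"
        using less rk_par by auto
      moreover have "reach S (tree_edges T r par) x (par x)"
        using x less.prems by (auto intro!: reach_edge simp: tree_edges_def)
      ultimately show ?thesis by (blast intro: reach_trans)
    qed simp
  qed
  then show ?thesis unfolding connected_on_reach by (blast intro: reach_sym reach_trans)
qed

end

text \<open>The rank is the distance from an arbitrary root, and the parent is a neighbour at
  smaller distance. Any further edge would close a cycle with the tree path between its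
  ends.\<close>

lemma is_tree_rooted:
  assumes "is_tree T E"
  obtains r par rk where "rooted_tree T r par rk" "E = tree_edges T r par"
proof -
  have "T \<noteq> {}" using assms by (simp add: is_tree_def)
  then obtain r where r: "r \<in> T" by blast
  have gr: "graph T E" and conn: "connected_on T E" and acyc: "\<And>cs. \<not> is_cycle E cs"
    using assms by (auto simp: is_tree_def)
  define R where "R = (\<lambda>x y. {x, y} \<in> E \<and> x \<in> T \<and> y \<in> T)"
  define rk where "rk x = (LEAST n. (R ^^ n) r x)" for x
  have rk: "(R ^^ rk x) r x" if "x \<in> T" for x
  proof -
    have "R\<^sup>*\<^sup>* r x" using conn r that by (auto simp: connected_on_def R_def)
    then show ?thesis unfolding rk_def by (metis LeastI_ex rtranclp_power)
  qed
  have "\<exists>y. {x, y} \<in> E \<and> y \<in> T \<and> rk y < rk x" if x: "x \<in> T" "x \<noteq> r" for x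
  proof (cases "rk x")
    case 0
    then show ?thesis using rk[OF x(1)] x(2) by simp
  next
    case (Suc n)
    then obtain y where y: "(R ^^ n) r y" "R y x" using rk[OF x(1)] by auto
    then have "rk y \<le> n" unfolding rk_def by (simp add: Least_le)
    then show ?thesis using y Suc by (auto simp: R_def insert_commute)
  qed
  then obtain par where par: "\<And>x. x \<in> T \<Longrightarrow> x \<noteq> r \<Longrightarrow> {x, par x} \<in> E \<and> par x \<in> T \<and> rk (par x) < rk x"
    by metis
  interpret rooted_tree T r par rk
    using gr r par by unfold_locales (auto simp: graph_def)
  have sub: "tree_edges T r par \<subseteq> E" using par by (auto simp: tree_edges_def)
  have "e \<in> tree_edges T r par" if e: "e \<in> E" for e
  proof (rule ccontr)
    assume ne: "e \<notin> tree_edges T r par"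
    obtain u v where uv: "e = {u, v}" "u \<noteq> v" "u \<in> T" "v \<in> T"
      using gr e by (auto simp: graph_def)
    have "reach T (tree_edges T r par) u v"
      using uv reach_root reach_sym reach_trans by meson
    then obtain xs where xs: "xs \<noteq> []" "distinct xs" "hd xs = u" "last xs = v" "walk (tree_edges T r par) xs"
      using uv(3) by (blast elim: reach_path)
    have "length xs \<ge> 3"
    proof (rule ccontr)
      assume "\<not> length xs \<ge> 3"
      then have "length xs = Suc 0 \<or> length xs = Suc (Suc 0)"
        using xs(1) by (cases "length xs") auto
      then consider a where "xs = [a]" | a b where "xs = [a, b]"
        by (auto simp: length_Suc_conv)
      then show False using xs uv ne by cases (auto simp: walk_def)
    qed
    then have "is_cycle E xs"
      using xs sub uv e by (auto simp: is_cycle_def walk_nth insert_commute)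
    then show False using acyc by blast
  qed
  then show ?thesis using that sub rooted_tree_axioms by blast
qed

section \<open>Treewidth bounds from elimination orderings\<close>

text \<open>\<open>K\<close> gives the earlier neighbours in a perfect elimination ordering of a
  chordal supergraph. The node of \<open>v\<close> has the bag \<open>insert v (K v)\<close> and
  hangs below the node of the latest member of \<open>K v\<close>, whose bag contains all of
  \<open>K v\<close> because \<open>K v\<close> is a clique.\<close>

lemma treewidth_le_chordal:
  fixes rk :: "nat \<Rightarrow> nat"
  assumes gr: "graph V E"
    and K: "\<And>v. v \<in> V \<Longrightarrow> K v \<subseteq> V" "\<And>v. v \<in> V \<Longrightarrow> card (K v) \<le> k"
    and rk: "\<And>u v. v \<in> V \<Longrightarrow> u \<in> K v \<Longrightarrow> rk u < rk v"
    and cl: "\<And>u u' v. v \<in> V \<Longrightarrow> u \<in> K v \<Longrightarrow> u' \<in> K v \<Longrightarrow> u \<noteq> u' \<Longrightarrow> u \<in> K u' \<or> u' \<in> K u"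
    and edge: "\<And>u v. {u, v} \<in> E \<Longrightarrow> u \<in> K v \<or> v \<in> K u"
  shows "treewidth V E \<le> k"
proof -
  have fin: "finite V" using gr by (simp add: graph_def)
  have "\<exists>u\<in>K v. K v \<subseteq> insert u (K u)" if v: "v \<in> V" "K v \<noteq> {}" for v
  proof -
    have "finite (K v)" using K(1) v fin finite_subset by blast
    then obtain u where u: "u \<in> K v" "\<And>w. w \<in> K v \<Longrightarrow> rk w \<le> rk u"
      using v(2) ex_max_nat[of "K v" rk] by blast
    have "w \<in> insert u (K u)" if w: "w \<in> K v" for w
    proof (rule ccontr)
      assume n: "w \<notin> insert u (K u)"
      then have "u \<in> K w" using cl[OF v(1) u(1) w] by auto
      moreover have "w \<in> V" using K(1)[OF v(1)] w by auto
      ultimately show False using rk[of w u] u(2)[OF w] by simp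
    qed
    then show ?thesis using u by blast
  qed
  then obtain pm where pm: "\<And>v. v \<in> V \<Longrightarrow> K v \<noteq> {} \<Longrightarrow> pm v \<in> K v \<and> K v \<subseteq> insert (pm v) (K (pm v))"
    by metis
  \<comment> \<open>The shift by \<open>Suc\<close> frees \<open>0\<close> for a root with empty
    bag, which becomes the parent of every vertex without earlier neighbours.\<close>
  define T where "T = insert 0 (Suc ` V)"
  define par where "par x = (case x of 0 \<Rightarrow> 0 | Suc v \<Rightarrow> if K v = {} then 0 else Suc (pm v))" for x
  define rk' where "rk' x = (case x of 0 \<Rightarrow> 0 | Suc v \<Rightarrow> Suc (rk v))" for x
  define bag where "bag x = (case x of 0 \<Rightarrow> {} | Suc v \<Rightarrow> insert v (K v))" for x
  interpret rooted_tree T 0 par rk'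
  proof
    show "par x \<in> T" if "x \<in> T" "x \<noteq> 0" for x
    proof -
      obtain v where "x = Suc v" "v \<in> V" using \<open>x \<in> T\<close> \<open>x \<noteq> 0\<close> by (auto simp: T_def)
      then show ?thesis using pm[of v] K(1)[of v] by (auto simp: par_def T_def)
    qed
    show "rk' (par x) < rk' x" if "x \<in> T" "x \<noteq> 0" for x
    proof -
      obtain v where "x = Suc v" "v \<in> V" using \<open>x \<in> T\<close> \<open>x \<noteq> 0\<close> by (auto simp: T_def)
      then show ?thesis using pm[of v] rk[of v "pm v"] by (simp add: par_def rk'_def)
    qed
  qed (use fin in \<open>auto simp: T_def\<close>)
  have "connected_on {x \<in> T. v \<in> bag x} (tree_edges T 0 par)" if v: "v \<in> V" for v
  proof (rule subtree_connected)
    have "x \<noteq> 0 \<and> par x \<in> T \<and> v \<in> bag (par x)" if x: "x \<in> T" "v \<in> bag x" "x \<noteq> Suc v" for x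
    proof -
      obtain w where w: "x = Suc w" "w \<in> V" "v \<in> K w" using x by (auto simp: T_def bag_def)
      then show ?thesis using par_in[OF x(1)] pm[of w] by (auto simp: bag_def par_def)
    qed
    then show "subtree {x \<in> T. v \<in> bag x} (Suc v)"
      using v unfolding subtree_def by (auto simp: T_def bag_def)
  qed
  moreover have "\<exists>x\<in>T. e \<subseteq> bag x" if "e \<in> E" for e
  proof -
    obtain u v where uv: "e = {u, v}" "u \<in> V" "v \<in> V"
      using graph_edgeE[OF gr \<open>e \<in> E\<close>] by metis
    then consider "u \<in> K v" | "v \<in> K u" using edge \<open>e \<in> E\<close> by blast
    then show ?thesis using uv by cases (auto simp: T_def bag_def)
  qed
  moreover have "\<forall>x\<in>T. card (bag x) \<le> k + 1"
  proof
    fix x assume "x \<in> T"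
    then consider "x = 0" | v where "x = Suc v" "v \<in> V" by (auto simp: T_def)
    then show "card (bag x) \<le> k + 1"
    proof cases
      case 2
      then have "card (insert v (K v)) \<le> Suc (card (K v))" by (intro card_insert_le_m1) auto
      then show ?thesis using K(2)[of v] 2 by (simp add: bag_def)
    qed (simp add: bag_def)
  qed
  moreover have "\<forall>x\<in>T. bag x \<subseteq> V" "\<forall>v\<in>V. \<exists>x\<in>T. v \<in> bag x"
    using K(1) by (auto simp: T_def bag_def)
  ultimately have "tree_decomp_width_le V E k T (tree_edges T 0 par) bag"
    using is_tree by (auto simp: tree_decomp_width_le_def)
  then show ?thesis unfolding treewidth_def by (blast intro: Least_le)
qed

section \<open>Packing and separation in tree decompositions\<close>

locale rooted_decomp = rooted_tree +
  fixes V :: "nat set" and E :: "nat set set" and bag :: "nat \<Rightarrow> nat set" and k :: nat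
  assumes graph: "graph V E"
    and bag_sub: "x \<in> T \<Longrightarrow> bag x \<subseteq> V"
    and bag_cover: "v \<in> V \<Longrightarrow> \<exists>x\<in>T. v \<in> bag x"
    and bag_edge: "{u, v} \<in> E \<Longrightarrow> \<exists>x\<in>T. u \<in> bag x \<and> v \<in> bag x"
    and bag_conn: "v \<in> V \<Longrightarrow> connected_on {x \<in> T. v \<in> bag x} (tree_edges T r par)"
    and bag_card: "x \<in> T \<Longrightarrow> card (bag x) \<le> k + 1"
begin

lemma finite_V: "finite V"
  using graph by (simp add: graph_def)

lemma finite_bag: "x \<in> T \<Longrightarrow> finite (bag x)"
  using bag_sub finite_V finite_subset by blast

definition nodes :: "nat set \<Rightarrow> nat set" where
  "nodes C = {x \<in> T. bag x \<inter> C \<noteq> {}}"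

text \<open>The ends of an edge share a bag, so along a walk in \<open>C\<close> the connected node
  sets of consecutive vertices overlap.\<close>

lemma nodes_connected:
  assumes "C \<subseteq> V" "connected_on C E"
  shows "connected_on (nodes C) (tree_edges T r par)"
proof -
  have sing: "reach (nodes C) (tree_edges T r par) x y"
    if "w \<in> C" "x \<in> T" "w \<in> bag x" "y \<in> T" "w \<in> bag y" for w x y
  proof -
    have "reach {x \<in> T. w \<in> bag x} (tree_edges T r par) x y"
      using bag_conn[of w] that assms(1) by (auto simp: connected_on_reach)
    then show ?thesis by (rule reach_mono) (use that in \<open>auto simp: nodes_def\<close>)
  qed
  have main: "\<forall>y\<in>T. v \<in> bag y \<longrightarrow> reach (nodes C) (tree_edges T r par) x y"
    if "reach C E u v" "u \<in> C" "x \<in> T" "u \<in> bag x" for u v x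
    using that(1) unfolding reach_def[of C]
  proof (induction rule: rtranclp_induct)
    case base
    then show ?case using sing that by blast
  next
    case (step w v)
    then obtain z where z: "z \<in> T" "w \<in> bag z" "v \<in> bag z" using bag_edge by blast
    then have "reach (nodes C) (tree_edges T r par) x z" using step by blast
    then show ?case using sing[of v z] z step by (blast intro: reach_trans)
  qed
  show ?thesis unfolding connected_on_reach
  proof (intro ballI)
    fix x y assume "x \<in> nodes C" "y \<in> nodes C"
    then obtain u v where uv: "x \<in> T" "y \<in> T" "u \<in> bag x" "u \<in> C" "v \<in> bag y" "v \<in> C"
      by (auto simp: nodes_def)
    then have "reach C E u v" using assms(2) by (simp add: connected_on_reach)
    then show "reach (nodes C) (tree_edges T r par) x y" using main uv by blast
  qed
qed

lemma nodes_subtree: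
  assumes "C \<subseteq> V" "connected_on C E" "C \<noteq> {}"
  shows "\<exists>m. subtree (nodes C) m"
proof (rule connected_subtree[OF nodes_connected[OF assms(1,2)]])
  obtain v where "v \<in> C" using assms(3) by blast
  then show "nodes C \<noteq> {}" using bag_cover[of v] assms(1) by (auto simp: nodes_def)
  show "nodes C \<subseteq> T" by (auto simp: nodes_def)
qed

lemma nodes_meet:
  assumes "C \<subseteq> V" "C \<inter> C' \<noteq> {}"
  shows "nodes C \<inter> nodes C' \<noteq> {}"
proof -
  obtain v where "v \<in> C" "v \<in> C'" using assms(2) by blast
  then show ?thesis using bag_cover[of v] assms(1) by (auto simp: nodes_def)
qed

text \<open>\<open>m\<close> is a topmost node of largest rank; by \<open>subtree_meet\<close> it
  lies in every node set that meets that of its owner \<open>C0\<close>.\<close>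

lemma top_meets:
  assumes F: "finite F" "F \<noteq> {}"
    and conn: "\<And>C. C \<in> F \<Longrightarrow> C \<subseteq> V \<and> connected_on C E \<and> C \<noteq> {}"
  obtains C0 m where "C0 \<in> F" "m \<in> nodes C0"
    "\<And>C. C \<in> F \<Longrightarrow> nodes C \<inter> nodes C0 \<noteq> {} \<Longrightarrow> m \<in> nodes C"
proof -
  obtain top where top: "\<And>C. C \<in> F \<Longrightarrow> subtree (nodes C) (top C)"
    using nodes_subtree conn by metis
  obtain C0 where C0: "C0 \<in> F" "\<And>C. C \<in> F \<Longrightarrow> rk (top C) \<le> rk (top C0)"
    using ex_max_nat[OF F, of "\<lambda>C. rk (top C)"] by blast
  show ?thesis
  proof (rule that[OF C0(1), of "top C0"])
    show "top C0 \<in> nodes C0" using top[OF C0(1)] by (simp add: subtree_def)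
    show "top C0 \<in> nodes C" if "C \<in> F" "nodes C \<inter> nodes C0 \<noteq> {}" for C
      using subtree_meet[OF top[OF C0(1)] top[OF that(1)]] C0(2)[OF that(1)] that(2) by blast
  qed
qed

text \<open>Touching sets share a bag, so by \<open>top_meets\<close> a single bag meets every
  member, and disjoint members use different vertices of it.\<close>

lemma clique_minor_bound:
  assumes F: "finite F"
    and conn: "\<And>C. C \<in> F \<Longrightarrow> C \<subseteq> V \<and> connected_on C E \<and> C \<noteq> {}"
    and disj: "pairwise disjnt F"
    and touch: "\<And>C C'. C \<in> F \<Longrightarrow> C' \<in> F \<Longrightarrow> C \<noteq> C' \<Longrightarrow> \<exists>u\<in>C. \<exists>v\<in>C'. {u, v} \<in> E"
  shows "card F \<le> k + 1"
proof (cases "F = {}")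
  case False
  then obtain C0 m where m: "C0 \<in> F" "m \<in> nodes C0"
    "\<And>C. C \<in> F \<Longrightarrow> nodes C \<inter> nodes C0 \<noteq> {} \<Longrightarrow> m \<in> nodes C"
    using top_meets[OF F _ conn] by blast
  have "m \<in> nodes C" if C: "C \<in> F" for C
  proof (cases "C = C0")
    case False
    then obtain u v where "u \<in> C" "v \<in> C0" "{u, v} \<in> E" using touch C m(1) by blast
    then show ?thesis using bag_edge[of u v] by (intro m(3) C) (auto simp: nodes_def)
  qed (use m in simp)
  then have "\<forall>C\<in>F. \<exists>v. v \<in> bag m \<inter> C" by (auto simp: nodes_def)
  then obtain f where f: "\<And>C. C \<in> F \<Longrightarrow> f C \<in> bag m \<inter> C" by (auto dest!: bchoice)
  have "inj_on f F"
  proof (rule inj_onI, rule ccontr)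
    fix C C' assume C: "C \<in> F" "C' \<in> F" "f C = f C'" "C \<noteq> C'"
    then have "disjnt C C'" using disj by (simp add: pairwise_def)
    then show False using f[OF C(1)] f[OF C(2)] C(3) by (auto simp: disjnt_iff)
  qed
  moreover have "f ` F \<subseteq> bag m" using f by blast
  moreover have mT: "m \<in> T" using m(2) by (simp add: nodes_def)
  ultimately show ?thesis
    using card_inj_on_le[of f F "bag m"] finite_bag bag_card[OF mT] by simp
qed simp

text \<open>Peel off a member whose topmost node is lowest: the bag of that node meets every member
  that the peeled one meets.\<close>
lemma packing_or_hitting:
  assumes "\<And>C. C \<in> F \<Longrightarrow> C \<subseteq> V \<and> connected_on C E \<and> C \<noteq> {}"
  shows "\<exists>Z\<subseteq>T. card Z \<le> N \<and>
    ((\<forall>C\<in>F. C \<inter> \<Union>(bag ` Z) \<noteq> {}) \<or> (\<exists>D\<subseteq>F. card D = N \<and> finite D \<and> pairwise disjnt D))"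
  using assms
proof (induction N arbitrary: F)
  case 0
  show ?case by (intro exI[of _ "{}"] conjI disjI2) (auto intro!: exI[of _ "{}"])
next
  case (Suc N)
  show ?case
  proof (cases "F = {}")
    case False
    have "finite F" by (rule finite_subset[of _ "Pow V"]) (use Suc.prems finite_V in auto)
    then obtain C0 m where m: "C0 \<in> F" "m \<in> nodes C0"
      "\<And>C. C \<in> F \<Longrightarrow> nodes C \<inter> nodes C0 \<noteq> {} \<Longrightarrow> m \<in> nodes C"
      using top_meets[OF _ False Suc.prems] by blast
    \<comment> \<open>No member of \<open>F'\<close> meets \<open>C0\<close>, since it would then
      meet \<open>bag m\<close>. So \<open>C0\<close> extends any packing in \<open>F'\<close>, and
      \<open>m\<close> extends any hitting set for \<open>F'\<close>.\<close>
    define F' where "F' = {C \<in> F. C \<inter> bag m = {}}"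
    have "\<exists>Z\<subseteq>T. card Z \<le> N \<and> ((\<forall>C\<in>F'. C \<inter> \<Union>(bag ` Z) \<noteq> {}) \<or>
        (\<exists>D\<subseteq>F'. card D = N \<and> finite D \<and> pairwise disjnt D))"
      by (rule Suc.IH) (use Suc.prems in \<open>simp add: F'_def\<close>)
    then obtain Z where Z: "Z \<subseteq> T" "card Z \<le> N"
      "(\<forall>C\<in>F'. C \<inter> \<Union>(bag ` Z) \<noteq> {}) \<or> (\<exists>D\<subseteq>F'. card D = N \<and> finite D \<and> pairwise disjnt D)"
      by (elim exE conjE) (rule that)
    have mT: "m \<in> T" using m(2) by (simp add: nodes_def)
    have fZ: "finite Z" using Z(1) finite_T finite_subset by blast
    from Z(3) show ?thesis
    proof
      assume "\<forall>C\<in>F'. C \<inter> \<Union>(bag ` Z) \<noteq> {}"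
      then have "\<forall>C\<in>F. C \<inter> \<Union>(bag ` insert m Z) \<noteq> {}"
        unfolding F'_def by fastforce
      moreover have "card (insert m Z) \<le> Suc N" using Z(2) fZ by (simp add: card_insert_if)
      ultimately show ?thesis using Z(1) mT by (intro exI[of _ "insert m Z"]) auto
    next
      assume "\<exists>D\<subseteq>F'. card D = N \<and> finite D \<and> pairwise disjnt D"
      then obtain D where D: "D \<subseteq> F'" "card D = N" "finite D" "pairwise disjnt D" by blast
      have d: "disjnt C0 C" if "C \<in> F'" for C
      proof (rule ccontr)
        assume "\<not> disjnt C0 C"
        then have "nodes C \<inter> nodes C0 \<noteq> {}"
          using nodes_meet[of C C0] that Suc.prems by (auto simp: F'_def disjnt_def)
        then have "m \<in> nodes C" using m(3) that by (auto simp: F'_def)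
        then show False using that by (auto simp: F'_def nodes_def)
      qed
      have "C0 \<notin> D" using D(1) m(2) by (auto simp: F'_def nodes_def)
      then have "card (insert C0 D) = Suc N" using D by simp
      moreover have "pairwise disjnt (insert C0 D)"
        using D d by (auto simp: pairwise_insert disjnt_sym)
      moreover have "insert C0 D \<subseteq> F" using D(1) m(1) by (auto simp: F'_def)
      ultimately show ?thesis using D(3) by (intro exI[of _ "{}"]) auto
    qed
  qed (intro exI[of _ "{}"], simp)
qed

section \<open>Closure under lowest common ancestors\<close>

text \<open>Lowest common ancestors are avoided as an operation: the members below any
  \<open>x\<close>, if there are some, have a topmost one. When \<open>x\<close> is the lowest
  common ancestor of two members, that one can only be \<open>x\<close>.\<close>

definition lca_closed :: "nat set \<Rightarrow> bool" where
  "lca_closed M \<longleftrightarrow>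
    (\<forall>x. (\<exists>y\<in>M. anc x y) \<longrightarrow> (\<exists>y\<in>M. anc x y \<and> (\<forall>z\<in>M. anc x z \<longrightarrow> anc y z)))"

text \<open>One extra node suffices, namely the lowest ancestor \<open>l\<close> of \<open>z\<close>
  that still has a member of \<open>M\<close> below it.\<close>

lemma lca_closed_insert:
  assumes M: "lca_closed M" "M \<noteq> {}" "M \<subseteq> T" and z: "z \<in> T"
  obtains l where "l \<in> T" "lca_closed (insert l (insert z M))"
proof -
  define R where "R = {x. anc x z \<and> (\<exists>y\<in>M. anc x y)}"
  have "R \<subseteq> T" using anc_in z by (auto simp: R_def)
  then have "finite R" using finite_T finite_subset by blast
  moreover have "r \<in> R" using M z anc_root by (auto simp: R_def)
  ultimately obtain l where l: "l \<in> R" "\<And>x. x \<in> R \<Longrightarrow> rk x \<le> rk l"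
    using ex_max_nat[of R rk] by blast
  have lz: "anc l z" using l by (simp add: R_def)
  have below: "anc x l" if x: "x \<in> R" for x
  proof -
    have "anc x z" using x by (simp add: R_def)
    then consider "anc x l" | "anc l x" using anc_comparable lz by blast
    then show ?thesis
    proof cases
      case 2
      then have "x = l" using anc_rk[OF 2] l(2)[OF x] by simp
      then show ?thesis by simp
    qed
  qed
  show ?thesis
  proof (rule that[of l])
    show "l \<in> T" using l(1) \<open>R \<subseteq> T\<close> by blast
    show "lca_closed (insert l (insert z M))"
      unfolding lca_closed_def
    proof (intro allI impI)
      fix x assume ex: "\<exists>y\<in>insert l (insert z M). anc x y"
      show "\<exists>y\<in>insert l (insert z M). anc x y \<and> (\<forall>w\<in>insert l (insert z M). anc x w \<longrightarrow> anc y w)"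
      \<comment> \<open>If \<open>x\<close> is not above \<open>z\<close>, only members of
        \<open>M\<close> are below it. If \<open>x\<close> is above \<open>z\<close> but above no
        member of \<open>M\<close>, only \<open>z\<close> counts. Otherwise \<open>x\<close> is
        above \<open>l\<close>, and the topmost node is \<open>l\<close> or the old topmost
        one.\<close>
      proof (cases "anc x z")
        case False
        then have nl: "\<not> anc x l" using lz by (meson rtrancl_trans)
        then obtain y where "y \<in> M" "anc x y" "\<forall>w\<in>M. anc x w \<longrightarrow> anc y w"
          using ex False M(1) unfolding lca_closed_def by (metis insertE)
        then show ?thesis using False nl by blast
      next
        case xz: True
        show ?thesis
        proof (cases "x \<in> R")
          case False
          then have no: "\<And>w. w \<in> M \<Longrightarrow> \<not> anc x w" using xz by (auto simp: R_def)
          have "\<not> anc x l"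
          proof
            assume "anc x l"
            moreover obtain y where "y \<in> M" "anc l y" using l(1) by (auto simp: R_def)
            ultimately show False using no by (meson rtrancl_trans)
          qed
          then show ?thesis using no xz by blast
        next
          case True
          then have xl: "anc x l" by (rule below)
          obtain y where y: "y \<in> M" "anc x y" "\<forall>w\<in>M. anc x w \<longrightarrow> anc y w"
            using True M(1) by (auto simp: R_def lca_closed_def)
          obtain w where w: "w \<in> M" "anc l w" using l(1) by (auto simp: R_def)
          then have "anc y w" using y xl by (meson rtrancl_trans)
          then consider "anc y l" | "anc l y" using anc_comparable w by blast
          then show ?thesis
          proof cases
            case 1
            then have "anc y z" using lz by (meson rtrancl_trans)
            then show ?thesis using y 1 by blast
          next
            case 2
            then have "\<forall>w\<in>M. anc x w \<longrightarrow> anc l w" using y by (meson rtrancl_trans)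
            then show ?thesis using xl lz by blast
          qed
        qed
      qed
    qed
  qed
qed

text \<open>Each element of \<open>Z\<close> costs at most two nodes, itself and one branching
  node.\<close>

lemma lca_closure:
  assumes "finite Z" "Z \<subseteq> T"
  shows "\<exists>M. Z \<subseteq> M \<and> M \<subseteq> T \<and> lca_closed M \<and> card M \<le> 2 * card Z"
  using assms
proof (induction Z)
  case empty
  show ?case by (intro exI[of _ "{}"]) (simp add: lca_closed_def)
next
  case (insert z Z)
  then obtain M where M: "Z \<subseteq> M" "M \<subseteq> T" "lca_closed M" "card M \<le> 2 * card Z" by blast
  have fM: "finite M" using M(2) finite_T finite_subset by blast
  show ?case
  proof (cases "M = {}")
    case True
    then show ?thesis using insert M by (intro exI[of _ "{z}"]) (auto simp: lca_closed_def)
  next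
    case False
    then obtain l where l: "l \<in> T" "lca_closed (insert l (insert z M))"
      using lca_closed_insert[of M z] M insert.prems by blast
    have "card (insert l (insert z M)) \<le> Suc (Suc (card M))"
      using fM by (simp add: card_insert_if)
    then have "card (insert l (insert z M)) \<le> 2 * card (insert z Z)"
      using M(4) insert.hyps by simp
    then show ?thesis using M l insert.prems by (intro exI[of _ "insert l (insert z M)"]) auto
  qed
qed

text \<open>The component of the tree minus \<open>M\<close> containing \<open>nodes C\<close> has at most two neighbours in \<open>M\<close>:
  the parent of its topmost node \<open>x0\<close> and, by closedness, one node below \<open>x0\<close>.\<close>
lemma lca_closed_nbrs:
  assumes M: "M \<subseteq> T" "lca_closed M"
    and C: "C \<subseteq> V" "connected_on C E" "C \<noteq> {}" "C \<inter> \<Union>(bag ` M) = {}"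
  shows "card {v \<in> \<Union>(bag ` M). \<exists>u\<in>C. {u, v} \<in> E} \<le> 2 * (k + 1)"
proof -
  obtain m where m: "subtree (nodes C) m" using nodes_subtree C by blast
  have mT: "m \<in> T" using m by (auto simp: subtree_def)
  have SM: "nodes C \<inter> M = {}" using C(4) by (auto simp: nodes_def)
  have mM: "m \<notin> M" using m SM by (auto simp: subtree_def)
  \<comment> \<open>\<open>R\<close> holds the ancestors of \<open>m\<close> with no member of
    \<open>M\<close> between them and \<open>m\<close>. Its topmost element \<open>x0\<close> is the
    top of the component of the tree minus \<open>M\<close> that contains \<open>m\<close>.\<close>
  define R where "R = {x. anc x m \<and> (\<forall>y\<in>M. anc x y \<longrightarrow> \<not> anc y m)}"
  have "m \<in> R" using mM anc_antisym by (auto simp: R_def)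
  then obtain x0 where x0: "x0 \<in> R" "\<And>x. x \<in> R \<Longrightarrow> rk x0 \<le> rk x"
    using ex_has_least_nat[of "\<lambda>x. x \<in> R" m rk] by blast
  have x0m: "anc x0 m" and x0M: "\<And>y. y \<in> M \<Longrightarrow> anc x0 y \<Longrightarrow> \<not> anc y m"
    using x0(1) by (auto simp: R_def)
  have x0T: "x0 \<in> T" using anc_in[OF x0m mT] .
  have strict: "anc y (par x0)" if "anc y x0" "y \<noteq> x0" for y
    using that(1)
  proof (cases rule: converse_rtranclE)
    case (step w)
    then show ?thesis by (auto simp: up_def)
  qed (use that in simp)
  have parM: "par x0 \<in> M" if "x0 \<noteq> r"
  proof (rule ccontr)
    assume n: "par x0 \<notin> M"
    have px: "anc (par x0) x0" using that x0T by (auto simp: up_def)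
    have "par x0 \<in> R" unfolding R_def
    proof (intro CollectI conjI ballI impI notI)
      show "anc (par x0) m" using px x0m by (meson rtrancl_trans)
      fix y assume y: "y \<in> M" "anc (par x0) y" "anc y m"
      then have "\<not> anc x0 y" using x0M by blast
      then have "anc y x0" "y \<noteq> x0" using anc_comparable[OF y(3) x0m] by auto
      then have "anc y (par x0)" by (rule strict)
      then have "y = par x0" using y(2) anc_antisym by blast
      then show False using n y by simp
    qed
    then show False using x0(2) rk_par[OF x0T that] by fastforce
  qed
  define A where "A = (if x0 = r then {} else bag (par x0))"
  have A: "finite A" "card A \<le> k + 1"
    using parM M(1) finite_bag bag_card by (auto simp: A_def)
  \<comment> \<open>\<open>B\<close> is the bag of the topmost member of \<open>M\<close> below
    \<open>x0\<close>, or empty if there is none.\<close>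
  obtain B where B: "finite B" "card B \<le> k + 1"
    and Bv: "\<And>y y'. y \<in> M \<Longrightarrow> anc x0 y \<Longrightarrow> \<exists>y0\<in>M. bag y0 = B \<and> anc x0 y0 \<and> anc y0 y"
  proof (cases "\<exists>y\<in>M. anc x0 y")
    case True
    then obtain y0 where "y0 \<in> M" "anc x0 y0" "\<forall>z\<in>M. anc x0 z \<longrightarrow> anc y0 z"
      using M(2) unfolding lca_closed_def by blast
    then show ?thesis using that[of "bag y0"] M(1) finite_bag bag_card by blast
  next
    case False
    then show ?thesis using that[of "{}"] by auto
  qed
  have "{v \<in> \<Union>(bag ` M). \<exists>u\<in>C. {u, v} \<in> E} \<subseteq> A \<union> B"
  proof
    fix v assume "v \<in> {v \<in> \<Union>(bag ` M). \<exists>u\<in>C. {u, v} \<in> E}"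
    then obtain y u where y: "y \<in> M" "v \<in> bag y" and u: "u \<in> C" "{u, v} \<in> E" by blast
    obtain z where z: "z \<in> T" "u \<in> bag z" "v \<in> bag z" using bag_edge u by blast
    have yT: "y \<in> T" using y M by blast
    have vV: "v \<in> V" using bag_sub z by blast
    define Sv where "Sv = {x \<in> T. v \<in> bag x}"
    have "connected_on Sv (tree_edges T r par)" using bag_conn[OF vV] by (simp add: Sv_def)
    then obtain t where t: "subtree Sv t"
      using connected_subtree[of Sv] z by (auto simp: Sv_def)
    have zS: "z \<in> nodes C" using z u by (auto simp: nodes_def)
    have mz: "anc m z" using subtree_anc[OF m zS] .
    have tz: "anc t z" "anc t y" using subtree_anc[OF t] z y yT by (auto simp: Sv_def)
    show "v \<in> A \<union> B"
    \<comment> \<open>The nodes whose bags contain \<open>v\<close> form a subtree through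
      \<open>z\<close> and \<open>y\<close>. It contains \<open>y0\<close> if \<open>y\<close> is
      below \<open>x0\<close>, and the parent of \<open>x0\<close> otherwise.\<close>
    proof (cases "anc x0 y")
      case True
      then obtain y0 where y0: "y0 \<in> M" "bag y0 = B" "anc x0 y0" "anc y0 y" using Bv y by blast
      have "\<not> anc y0 z"
      proof
        assume a: "anc y0 z"
        have "\<not> anc y0 m" using x0M y0 by blast
        then have "anc m y0" using anc_comparable[OF a mz] by blast
        then have "y0 \<in> nodes C" using subtree_between[OF m zS a] by blast
        then show False using SM y0 by blast
      qed
      then have "\<not> anc y0 t" using tz by (meson rtrancl_trans)
      then have "anc t y0" using anc_comparable y0(4) tz(2) by blast
      then have "y0 \<in> Sv" using subtree_between[OF t _ y0(4)] y yT by (auto simp: Sv_def)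
      then show ?thesis using y0 by (auto simp: Sv_def)
    next
      case False
      then have xr: "x0 \<noteq> r" using anc_root yT by blast
      have xz: "anc x0 z" using x0m mz by (meson rtrancl_trans)
      have nt: "\<not> anc x0 t" using False tz by (meson rtrancl_trans)
      then have "anc t x0" "t \<noteq> x0" using anc_comparable[OF tz(1) xz] by auto
      then have "anc t (par x0)" by (rule strict)
      moreover have "anc (par x0) x0" using xr x0T by (auto simp: up_def)
      then have "anc (par x0) z" using xz by (meson rtrancl_trans)
      ultimately have "par x0 \<in> Sv"
        using subtree_between[OF t, of z "par x0"] z by (simp add: Sv_def)
      then show ?thesis using xr by (simp add: A_def Sv_def)
    qed
  qed
  then have "card {v \<in> \<Union>(bag ` M). \<exists>u\<in>C. {u, v} \<in> E} \<le> card (A \<union> B)"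
    using A B by (intro card_mono) auto
  also have "\<dots> \<le> card A + card B" by (rule card_Un_le)
  finally show ?thesis using A B by simp
qed

end

text \<open>The decomposition with the single bag \<open>V\<close> shows that the minimum in
  \<open>treewidth\<close> is attained.\<close>

lemma ex_tree_decomp:
  assumes "graph V E"
  shows "\<exists>TV TE bag. tree_decomp_width_le V E (treewidth V E) TV TE bag"
proof -
  have "graph {0} {}" by (simp add: graph_def)
  moreover have "connected_on {x \<in> {0}. v \<in> V} {}" for v by (auto simp: connected_on_reach)
  moreover have "\<not> is_cycle {} cs" for cs by (simp add: is_cycle_def)
  moreover have "connected_on {0} {}" by (simp add: connected_on_reach)
  ultimately have "tree_decomp_width_le V E (card V) {0} {} (\<lambda>_. V)"
    using assms by (auto simp: tree_decomp_width_le_def is_tree_def graph_def)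
  then have "\<exists>k TV TE bag. tree_decomp_width_le V E k TV TE bag" by blast
  then show ?thesis unfolding treewidth_def by (rule LeastI_ex)
qed

lemma rooted_decomp_exists:
  assumes "graph V E"
  obtains T r par rk bag where "rooted_decomp T r par rk V E bag (treewidth V E)"
proof -
  obtain T TE bag where d: "tree_decomp_width_le V E (treewidth V E) T TE bag"
    using ex_tree_decomp[OF assms] by blast
  then obtain r par rk where t: "rooted_tree T r par rk" "TE = tree_edges T r par"
    unfolding tree_decomp_width_le_def using is_tree_rooted by metis
  interpret rooted_tree T r par rk by (rule t)
  have d': "\<forall>x\<in>T. bag x \<subseteq> V" "\<forall>v\<in>V. \<exists>x\<in>T. v \<in> bag x" "\<forall>e\<in>E. \<exists>x\<in>T. e \<subseteq> bag x"
    "\<forall>v\<in>V. connected_on {x \<in> T. v \<in> bag x} (tree_edges T r par)"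
    "\<forall>x\<in>T. card (bag x) \<le> treewidth V E + 1"
    using d unfolding tree_decomp_width_le_def t(2) by simp_all
  have "rooted_decomp T r par rk V E bag (treewidth V E)"
  proof (unfold_locales, goal_cases)
    case (4 u v)
    then have "\<exists>x\<in>T. {u, v} \<subseteq> bag x" using d'(3) by blast
    then show ?case by simp
  qed (use d' assms in simp_all)
  then show ?thesis by (rule that)
qed

section \<open>Partitions of graphs without bundles\<close>

definition has_bundle :: "nat set \<Rightarrow> nat set set \<Rightarrow> nat \<Rightarrow> nat \<Rightarrow> bool" where
  "has_bundle V E c b \<longleftrightarrow>
    (\<exists>X B D. X \<subseteq> V \<and> connected_on X E \<and> B \<subseteq> V \<and> B \<inter> X = {} \<and> card B = c \<and>
      card D = b \<and> pairwise disjnt D \<and>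
      (\<forall>C\<in>D. C \<subseteq> X \<and> C \<noteq> {} \<and> connected_on C E \<and> (\<forall>v\<in>B. \<exists>u\<in>C. {u, v} \<in> E)))"

definition attach :: "nat set set \<Rightarrow> nat set \<Rightarrow> nat set \<Rightarrow> nat set" where
  "attach E P C = {v \<in> P. \<exists>u\<in>C. {u, v} \<in> E}"

text \<open>Adjacency is recorded only at the later of two parts, hence the test
  \<open>i < j\<close>.\<close>

definition clique_of :: "(nat \<Rightarrow> nat set) \<Rightarrow> nat set \<Rightarrow> bool" where
  "clique_of K S \<longleftrightarrow> (\<forall>i\<in>S. \<forall>j\<in>S. i < j \<longrightarrow> i \<in> K j)"

lemma clique_of_mono: "clique_of K S \<Longrightarrow> S' \<subseteq> S \<Longrightarrow> clique_of K S'"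
  by (auto simp: clique_of_def)

lemma H_partition_tpw_le:
  assumes H: "graph H F" "treewidth H F \<le> c" and p: "H_partition_width_le V E H F p w"
  shows "tpw c V E \<le> w"
  unfolding tpw_def by (rule Least_le) (use assms in blast)

lemma pigeonhole_fibre:
  assumes "finite D" "\<beta> ` D \<subseteq> S" "finite S" "card S * n \<le> card D" "n \<ge> 1" "D \<noteq> {}"
  obtains s where "s \<in> S" "n \<le> card {C \<in> D. \<beta> C = s}"
proof (rule ccontr)
  assume "\<not> thesis"
  then have small: "card {C \<in> D. \<beta> C = s} \<le> n - 1" if "s \<in> S" for s
    using that \<open>\<And>s. s \<in> S \<Longrightarrow> n \<le> card {C \<in> D. \<beta> C = s} \<Longrightarrow> thesis\<close> assms(5) by fastforce
  have "card D = card (\<Union>s\<in>S. {C \<in> D. \<beta> C = s})"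
    using assms(2) by (intro arg_cong[of _ _ card]) auto
  also have "\<dots> \<le> (\<Sum>s\<in>S. card {C \<in> D. \<beta> C = s})" by (rule card_UN_le[OF assms(3)])
  also have "\<dots> \<le> card S * (n - 1)" using sum_bounded_above[OF small] by simp
  also have "\<dots> < card S * n"
  proof -
    have "S \<noteq> {}" using assms(2,6) by auto
    then have "card S > 0" using assms(3) by (simp add: card_gt_0_iff)
    then show ?thesis using assms(5) by simp
  qed
  finally show False using assms(4) by simp
qed

section \<open>Greedy construction of the partition\<close>

context rooted_decomp
begin

text \<open>\<open>F\<close> collects the connected subsets of \<open>X\<close> that see all parts
  seen by \<open>X\<close>. When these are \<open>c\<close> parts, \<open>2 ^ s * b\<close> disjoint
  members of \<open>F\<close> would contain a bundle, so few bags hit all of \<open>F\<close>. What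
  avoids those bags misses at least one part.\<close>

lemma splitting_nodes:
  assumes nb: "\<not> has_bundle V E c b" and b: "b \<ge> 1"
    and X: "X \<subseteq> V" "connected_on X E" "X \<noteq> {}"
    and N: "N \<subseteq> V - X" "card N \<le> s" "card (p ` N) \<le> c"
  obtains M where "M \<subseteq> T" "lca_closed M" "card M \<le> 2 * (2 ^ s * b + s + 1)"
    "N \<subseteq> \<Union>(bag ` M)" "X \<inter> \<Union>(bag ` M) \<noteq> {}"
    "\<And>C. C \<subseteq> X \<Longrightarrow> C \<noteq> {} \<Longrightarrow> connected_on C E \<Longrightarrow> C \<inter> \<Union>(bag ` M) = {} \<Longrightarrow>
      card (p ` attach E N C) < c \<or> card (p ` N) < c"
proof -
  have fN: "finite N" using N(1) finite_V finite_subset by blast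
  define F where "F = {C. C \<subseteq> X \<and> C \<noteq> {} \<and> connected_on C E \<and> p ` N \<subseteq> p ` attach E N C}"
  have "\<exists>Z\<subseteq>T. card Z \<le> 2 ^ s * b \<and> (card (p ` N) < c \<or> (\<forall>C\<in>F. C \<inter> \<Union>(bag ` Z) \<noteq> {}))"
  proof (cases "card (p ` N) < c")
    case True
    then show ?thesis by (intro exI[of _ "{}"]) simp
  next
    case False
    then have cN: "card (p ` N) = c" using N(3) by simp
    have "\<exists>Z\<subseteq>T. card Z \<le> 2 ^ s * b \<and> ((\<forall>C\<in>F. C \<inter> \<Union>(bag ` Z) \<noteq> {}) \<or>
        (\<exists>D\<subseteq>F. card D = 2 ^ s * b \<and> finite D \<and> pairwise disjnt D))"
      by (rule packing_or_hitting) (use X in \<open>auto simp: F_def\<close>)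
    moreover have False if D: "D \<subseteq> F" "card D = 2 ^ s * b" "finite D" "pairwise disjnt D" for D
    proof -
      \<comment> \<open>Each piece picks one attached vertex from each of the \<open>c\<close>
        parts. There are at most \<open>2 ^ s\<close> possible choices, so some \<open>b\<close>
        pieces make the same one and form a bundle.\<close>
      have "\<exists>B. B \<subseteq> attach E N C \<and> card B = c" if "C \<in> D" for C
      proof -
        have "p ` N \<subseteq> p ` attach E N C" using that D(1) by (auto simp: F_def)
        then obtain B where "B \<subseteq> attach E N C" "inj_on p B" "p ` N = p ` B"
          by (auto simp: subset_image_inj)
        then show ?thesis using cN card_image[of p B] by auto
      qed
      then obtain \<beta> where \<beta>: "\<And>C. C \<in> D \<Longrightarrow> \<beta> C \<subseteq> attach E N C \<and> card (\<beta> C) = c" by metis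
      have "card (Pow N) * b \<le> card D" using N(2) D(2) fN by (simp add: card_Pow)
      moreover have "\<beta> ` D \<subseteq> Pow N" using \<beta> by (fastforce simp: attach_def)
      moreover have "D \<noteq> {}" using D(2) b by auto
      ultimately obtain B where B: "b \<le> card {C \<in> D. \<beta> C = B}"
        by (rule_tac pigeonhole_fibre[of D \<beta> "Pow N" b]) (use D(3) fN b in auto)
      then obtain D' where D': "D' \<subseteq> {C \<in> D. \<beta> C = B}" "card D' = b"
        by (rule obtain_subset_with_card_n)
      have "D' \<noteq> {}" using D'(2) b by auto
      then obtain C0 where "C0 \<in> D" "\<beta> C0 = B" using D' by blast
      then have Bc: "card B = c" "B \<subseteq> N" using \<beta> by (auto simp: attach_def)
      have "has_bundle V E c b" unfolding has_bundle_def
      proof (intro exI conjI ballI)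
        show "X \<subseteq> V" "connected_on X E" "B \<subseteq> V" "B \<inter> X = {}" "card B = c" "card D' = b"
          using X Bc N(1) D' by auto
        show "pairwise disjnt D'" by (rule pairwise_subset[OF D(4)]) (use D' in auto)
        fix C assume "C \<in> D'"
        then have C: "C \<in> D" "\<beta> C = B" using D' by auto
        then show "C \<subseteq> X" "C \<noteq> {}" "connected_on C E" using D(1) by (auto simp: F_def)
        fix v assume "v \<in> B"
        then show "\<exists>u\<in>C. {u, v} \<in> E" using \<beta>[OF C(1)] C(2) by (auto simp: attach_def)
      qed
      then show False using nb by blast
    qed
    ultimately show ?thesis by blast
  qed
  then obtain Z where Z: "Z \<subseteq> T" "card Z \<le> 2 ^ s * b"
    "card (p ` N) < c \<or> (\<forall>C\<in>F. C \<inter> \<Union>(bag ` Z) \<noteq> {})" by blast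
  obtain x where x: "x \<in> X" using X by blast
  obtain nd where nd: "\<And>v. v \<in> V \<Longrightarrow> nd v \<in> T \<and> v \<in> bag (nd v)" using bag_cover by metis
  \<comment> \<open>Including \<open>x\<close> makes the new part nonempty; including
    \<open>N\<close> puts every earlier vertex seen from \<open>X\<close> into a bag of
    \<open>M\<close>.\<close>
  define Z' where "Z' = Z \<union> nd ` insert x N"
  have fZ: "finite Z" using Z(1) finite_T finite_subset by blast
  have xN: "insert x N \<subseteq> V" using x X N by auto
  have "card (nd ` insert x N) \<le> s + 1"
    using card_image_le[of "insert x N" nd] fN N(2) card_insert_if[OF fN, of x]
    by (auto split: if_splits)
  then have "card Z' \<le> 2 ^ s * b + s + 1"
    using card_Un_le[of Z "nd ` insert x N"] Z(2) by (simp add: Z'_def)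
  moreover have "finite Z'" "Z' \<subseteq> T" using fZ fN Z(1) nd xN by (auto simp: Z'_def)
  ultimately obtain M where M: "Z' \<subseteq> M" "M \<subseteq> T" "lca_closed M" "card M \<le> 2 * (2 ^ s * b + s + 1)"
    using lca_closure[of Z'] by (metis (no_types, lifting) le_trans mult_le_mono2)
  have inM: "v \<in> \<Union>(bag ` M)" if "v \<in> insert x N" for v
  proof -
    have "nd v \<in> M" using that M(1) by (auto simp: Z'_def)
    moreover have "v \<in> bag (nd v)" using nd xN that by blast
    ultimately show ?thesis by blast
  qed
  show ?thesis
  proof (rule that[OF M(2-4)])
    show "N \<subseteq> \<Union>(bag ` M)" "X \<inter> \<Union>(bag ` M) \<noteq> {}" using inM x by blast+
    fix C assume C: "C \<subseteq> X" "C \<noteq> {}" "connected_on C E" "C \<inter> \<Union>(bag ` M) = {}"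
    show "card (p ` attach E N C) < c \<or> card (p ` N) < c"
    proof (rule disjCI)
      assume "\<not> card (p ` N) < c"
      then have "C \<notin> F" using Z(3) C(4) M(1) by (fastforce simp: Z'_def)
      then have "\<not> p ` N \<subseteq> p ` attach E N C" using C by (simp add: F_def)
      then have "p ` attach E N C \<subset> p ` N" by (auto simp: attach_def)
      then show "card (p ` attach E N C) < c"
        using psubset_card_mono[of "p ` N" "p ` attach E N C"] fN N(3) by simp
    qed
  qed
qed

text \<open>The bound on \<open>card M\<close> from \<open>splitting_nodes\<close> for
  \<open>s = 2 * (k + 1)\<close>, times the largest bag size.\<close>

definition part_bound :: "nat \<Rightarrow> nat" where
  "part_bound b = (k + 1) * (2 * (2 ^ (2 * (k + 1)) * b + 2 * (k + 1) + 1))"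

text \<open>The edges of \<open>H\<close> are encoded by \<open>K\<close>: the earlier neighbours of part \<open>i\<close> are the elements of
  \<open>K i\<close>.\<close>
definition partial_partition ::
    "nat \<Rightarrow> nat \<Rightarrow> nat set \<Rightarrow> (nat \<Rightarrow> nat) \<Rightarrow> nat \<Rightarrow> (nat \<Rightarrow> nat set) \<Rightarrow> bool" where
  "partial_partition c b P p h K \<longleftrightarrow>
     P \<subseteq> V \<and> (\<forall>v\<in>P. p v < h) \<and>
     (\<forall>i<h. K i \<subseteq> {..<i} \<and> card (K i) \<le> c \<and> clique_of K (K i)) \<and>
     (\<forall>u\<in>P. \<forall>v\<in>P. {u, v} \<in> E \<longrightarrow> p u = p v \<or> p u \<in> K (p v) \<or> p v \<in> K (p u)) \<and>
     (\<forall>i. card {v \<in> P. p v = i} \<le> part_bound b) \<and>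
     (\<forall>X\<subseteq>V - P. X \<noteq> {} \<and> connected_on X E \<longrightarrow>
        card (attach E P X) \<le> 2 * (k + 1) \<and> card (p ` attach E P X) \<le> c \<and>
        clique_of K (p ` attach E P X))"

lemma partial_partitionD:
  assumes "partial_partition c b P p h K"
  shows "P \<subseteq> V" and "v \<in> P \<Longrightarrow> p v < h"
    and "i < h \<Longrightarrow> K i \<subseteq> {..<i} \<and> card (K i) \<le> c \<and> clique_of K (K i)"
    and "u \<in> P \<Longrightarrow> v \<in> P \<Longrightarrow> {u, v} \<in> E \<Longrightarrow> p u = p v \<or> p u \<in> K (p v) \<or> p v \<in> K (p u)"
    and "card {v \<in> P. p v = i} \<le> part_bound b"
    and "X \<subseteq> V - P \<Longrightarrow> X \<noteq> {} \<Longrightarrow> connected_on X E \<Longrightarrow> card (attach E P X) \<le> 2 * (k + 1) \<and>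
      card (p ` attach E P X) \<le> c \<and> clique_of K (p ` attach E P X)"
proof -
  note d = assms[unfolded partial_partition_def]
  note d1 = conjunct2[OF d] note d2 = conjunct2[OF d1] note d3 = conjunct2[OF d2]
  note d4 = conjunct2[OF d3] note d5 = conjunct2[OF d4]
  show "P \<subseteq> V" using conjunct1[OF d] .
  show "v \<in> P \<Longrightarrow> p v < h" using conjunct1[OF d1] by blast
  show "i < h \<Longrightarrow> K i \<subseteq> {..<i} \<and> card (K i) \<le> c \<and> clique_of K (K i)"
    using conjunct1[OF d2] by blast
  show "u \<in> P \<Longrightarrow> v \<in> P \<Longrightarrow> {u, v} \<in> E \<Longrightarrow> p u = p v \<or> p u \<in> K (p v) \<or> p v \<in> K (p u)"
    using conjunct1[OF d3] by blast
  show "card {v \<in> P. p v = i} \<le> part_bound b" using conjunct1[OF d4] by blast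
  show "X \<subseteq> V - P \<Longrightarrow> X \<noteq> {} \<Longrightarrow> connected_on X E \<Longrightarrow> card (attach E P X) \<le> 2 * (k + 1) \<and>
      card (p ` attach E P X) \<le> c \<and> clique_of K (p ` attach E P X)"
    using d5 by simp
qed

text \<open>The new part \<open>h\<close> consists of the vertices of one uncovered component
  \<open>X\<close> that lie in bags of \<open>M\<close>. Its earlier neighbours are the parts seen
  from \<open>X\<close>, which are at most \<open>c\<close> and form a clique by the
  invariant.\<close>

lemma partial_partition_extend:
  assumes nb: "\<not> has_bundle V E c b" and b: "b \<ge> 1"
    and pp: "partial_partition c b P p h K" and "P \<noteq> V"
  obtains P' p' K' where "P \<subset> P'" "partial_partition c b P' p' (Suc h) K'"
proof -
  define s where "s = 2 * (k + 1)"
  have PV: "P \<subseteq> V" and ph: "\<And>v. v \<in> P \<Longrightarrow> p v < h"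
    and K: "\<And>i. i < h \<Longrightarrow> K i \<subseteq> {..<i} \<and> card (K i) \<le> c \<and> clique_of K (K i)"
    and edges: "\<And>u v. u \<in> P \<Longrightarrow> v \<in> P \<Longrightarrow> {u, v} \<in> E \<Longrightarrow> p u = p v \<or> p u \<in> K (p v) \<or> p v \<in> K (p u)"
    and wid: "\<And>i. card {v \<in> P. p v = i} \<le> part_bound b"
    and out: "\<And>X. X \<subseteq> V - P \<Longrightarrow> X \<noteq> {} \<Longrightarrow> connected_on X E \<Longrightarrow> card (attach E P X) \<le> s \<and>
      card (p ` attach E P X) \<le> c \<and> clique_of K (p ` attach E P X)"
    using partial_partitionD[OF pp] unfolding s_def by metis+
  obtain x where x: "x \<in> V - P" using PV assms(4) by blast
  define X where "X = {z. reach (V - P) E x z}"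
  have XV: "X \<subseteq> V - P" using x reach_in[of "V - P" E x] by (auto simp: X_def)
  have XV': "X \<subseteq> V" using XV by blast
  have Xne: "X \<noteq> {}" by (auto simp: X_def intro: exI[of _ x])
  have Xcon: "connected_on X E" unfolding X_def by (rule connected_on_component)
  have Xcl: "v \<in> X" if "u \<in> X" "{u, v} \<in> E" "v \<in> V - P" for u v
    using that XV reach_edge[of u v E "V - P"] by (auto simp: X_def intro: reach_trans)
  define N where "N = attach E P X"
  have NX: "N \<subseteq> V - X" using PV XV by (auto simp: N_def attach_def)
  have N: "card N \<le> s" "card (p ` N) \<le> c" "clique_of K (p ` N)"
    using out[OF XV Xne Xcon] by (auto simp: N_def)
  have fN: "finite N" using NX finite_V finite_subset by blast
  obtain M where M: "M \<subseteq> T" "lca_closed M" "card M \<le> 2 * (2 ^ s * b + s + 1)"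
    and NM: "N \<subseteq> \<Union>(bag ` M)" and XM: "X \<inter> \<Union>(bag ` M) \<noteq> {}"
    and miss: "\<And>C. C \<subseteq> X \<Longrightarrow> C \<noteq> {} \<Longrightarrow> connected_on C E \<Longrightarrow> C \<inter> \<Union>(bag ` M) = {} \<Longrightarrow>
      card (p ` attach E N C) < c \<or> card (p ` N) < c"
    by (rule splitting_nodes[OF nb b XV' Xcon Xne NX N(1,2)]) (rule that)
  define Q where "Q = X \<inter> \<Union>(bag ` M)"
  define p' where "p' v = (if v \<in> Q then h else p v)" for v
  define K' where "K' = K(h := p ` N)"
  have QP: "Q \<inter> P = {}" using XV by (auto simp: Q_def)
  have p'P: "p' v = p v" if "v \<in> P" for v using that QP by (auto simp: p'_def)
  have pN: "p ` N \<subseteq> {..<h}" using ph by (auto simp: N_def attach_def)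
  have clK: "clique_of K' S" if "clique_of K S" "S \<subseteq> {..<h}" for S
    using that by (auto simp: clique_of_def K'_def)
  have fM: "finite M" using M(1) finite_T finite_subset by blast
  show ?thesis
  proof (rule that[of "P \<union> Q" p' K'])
    show "P \<subset> P \<union> Q" using XM QP by (auto simp: Q_def)
    show "partial_partition c b (P \<union> Q) p' (Suc h) K'"
      unfolding partial_partition_def s_def[symmetric]
    proof (intro conjI allI ballI impI)
      show "P \<union> Q \<subseteq> V" using PV XV by (auto simp: Q_def)
      show "p' v < Suc h" if "v \<in> P \<union> Q" for v
        using that ph p'P by (auto simp: p'_def less_Suc_eq)
      show "K' i \<subseteq> {..<i}" "card (K' i) \<le> c" if "i < Suc h" for i
        using that K[of i] N(2) pN by (auto simp: K'_def less_Suc_eq)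
      show "clique_of K' (K' i)" if "i < Suc h" for i
      proof (cases "i = h")
        case True
        then show ?thesis using clK[OF N(3) pN] by (simp add: K'_def)
      next
        case False
        then have i: "i < h" using that by simp
        then have "K i \<subseteq> {..<h}" using K[of i] by fastforce
        then have "clique_of K' (K i)" using clK K[OF i] by blast
        then show ?thesis using i by (simp add: K'_def)
      qed
      show "p' u = p' v \<or> p' u \<in> K' (p' v) \<or> p' v \<in> K' (p' u)"
        if uv: "u \<in> P \<union> Q" "v \<in> P \<union> Q" "{u, v} \<in> E" for u v
      proof -
        have QN: "p w \<in> p ` N" if "z \<in> Q" "w \<in> P" "{z, w} \<in> E" for z w
          using that by (auto simp: N_def attach_def Q_def)
        consider "u \<in> Q" "v \<in> Q" | "u \<in> Q" "v \<in> P" | "u \<in> P" "v \<in> Q" | "u \<in> P" "v \<in> P"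
          using uv by blast
        then show ?thesis
        proof cases
          case 2
          then show ?thesis using QN[of u v] uv(3) p'P by (simp add: p'_def[of u] K'_def)
        next
          case 3
          then show ?thesis using QN[of v u] uv(3) p'P by (simp add: p'_def[of v] K'_def insert_commute)
        next
          case 4
          then show ?thesis using edges[OF 4 uv(3)] ph p'P by (auto simp: K'_def)
        qed (simp add: p'_def)
      qed
      show "card {v \<in> P \<union> Q. p' v = i} \<le> part_bound b" for i
      proof (cases "i = h")
        case True
        have "{v \<in> P \<union> Q. p' v = i} \<subseteq> \<Union>(bag ` M)"
          using True ph p'P by (force simp: Q_def)
        then have "card {v \<in> P \<union> Q. p' v = i} \<le> card (\<Union>(bag ` M))"
          using fM M(1) finite_bag by (intro card_mono) auto
        also have "\<dots> \<le> (\<Sum>x\<in>M. card (bag x))" by (rule card_UN_le[OF fM])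
        also have "\<dots> \<le> card M * (k + 1)"
          using sum_bounded_above[of M "\<lambda>x. card (bag x)" "k + 1"] bag_card M(1) by auto
        also have "\<dots> \<le> part_bound b"
          using M(3) unfolding part_bound_def s_def by (simp add: mult.commute del: mult_Suc mult_Suc_right)
        finally show ?thesis .
      next
        case False
        then have "{v \<in> P \<union> Q. p' v = i} = {v \<in> P. p v = i}"
          using QP by (auto simp: p'_def split: if_splits)
        then show ?thesis using wid by simp
      qed
      fix C assume C: "C \<subseteq> V - (P \<union> Q)" and "C \<noteq> {} \<and> connected_on C E"
      then have Cc: "C \<noteq> {}" "connected_on C E" by auto
      have CP: "C \<subseteq> V - P" using C by blast
      note outC = out[OF CP Cc]
      have "card (attach E (P \<union> Q) C) \<le> s \<and> card (p' ` attach E (P \<union> Q) C) \<le> c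
        \<and> clique_of K' (p' ` attach E (P \<union> Q) C)"
      \<comment> \<open>An uncovered connected set that misses \<open>X\<close> has no edge to
        \<open>X\<close>, so what it sees is unchanged; one that meets \<open>X\<close> lies inside
        \<open>X\<close>.\<close>
      proof (cases "C \<inter> X = {}")
        case True
        then have "attach E (P \<union> Q) C = attach E P C"
          using Xcl CP by (fastforce simp: attach_def Q_def insert_commute)
        moreover have "p' ` attach E P C = p ` attach E P C"
          using p'P by (intro image_cong) (auto simp: attach_def)
        moreover have "p ` attach E P C \<subseteq> {..<h}" using ph by (auto simp: attach_def)
        ultimately show ?thesis using outC clK by simp
      next
        case False
        then obtain y where y: "y \<in> C" "y \<in> X" by blast
        have CX: "C \<subseteq> X"
        proof
          fix z assume "z \<in> C"
          then have "reach C E y z" using Cc y by (simp add: connected_on_reach)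
          then show "z \<in> X" by (rule reach_closed) (use y Xcl CP in auto)
        qed
        have CM: "C \<inter> \<Union>(bag ` M) = {}" using CX C by (auto simp: Q_def)
        have sub: "attach E (P \<union> Q) C \<subseteq> attach E N C \<union> Q"
          using CX by (auto simp: attach_def N_def)
        \<comment> \<open>Everything seen from \<open>C\<close> lies in bags of \<open>M\<close>, so
          the bound \<open>s\<close> is regained from closedness instead of growing with each
          round.\<close>
        have "attach E (P \<union> Q) C \<subseteq> {v \<in> \<Union>(bag ` M). \<exists>u\<in>C. {u, v} \<in> E}"
          using sub NM by (auto simp: attach_def Q_def)
        moreover have "finite (\<Union>(bag ` M))" using fM M(1) finite_bag by blast
        then have "finite {v \<in> \<Union>(bag ` M). \<exists>u\<in>C. {u, v} \<in> E}"
          by (rule rev_finite_subset) blast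
        ultimately have "card (attach E (P \<union> Q) C) \<le> card {v \<in> \<Union>(bag ` M). \<exists>u\<in>C. {u, v} \<in> E}"
          by (rule card_mono[rotated])
        also have "\<dots> \<le> s"
          using lca_closed_nbrs[OF M(1,2) _ Cc(2,1) CM] C by (auto simp: s_def)
        finally have c1: "card (attach E (P \<union> Q) C) \<le> s" .
        have aN: "attach E N C \<subseteq> N" by (auto simp: attach_def)
        have NP: "N \<subseteq> P" by (auto simp: N_def attach_def)
        have img: "p' ` attach E (P \<union> Q) C \<subseteq> insert h (p ` attach E N C)"
          using sub p'P aN NP by (fastforce simp: p'_def)
        \<comment> \<open>Strictly fewer than \<open>c\<close> old parts leave room for
          \<open>h\<close>.\<close>
        have "card (p ` attach E N C) < c"
          using miss[OF CX Cc CM] card_mono[of "p ` N" "p ` attach E N C"] fN image_mono[OF aN, of p]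
          by fastforce
        then have "card (insert h (p ` attach E N C)) \<le> c"
          using finite_subset[OF aN fN] by (simp add: card_insert_if)
        then have c2: "card (p' ` attach E (P \<union> Q) C) \<le> c"
          using card_mono[OF _ img] finite_subset[OF aN fN] by fastforce
        have "clique_of K' (insert h (p ` N))"
          using clK[OF N(3) pN] pN by (auto simp: clique_of_def K'_def)
        then have "clique_of K' (p' ` attach E (P \<union> Q) C)"
          by (rule clique_of_mono) (use img aN in blast)
        then show ?thesis using c1 c2 by blast
      qed
      then show "card (attach E (P \<union> Q) C) \<le> s" "card (p' ` attach E (P \<union> Q) C) \<le> c"
        "clique_of K' (p' ` attach E (P \<union> Q) C)" by auto
    qed
  qed
qed

lemma partial_partition_complete:
  assumes nb: "\<not> has_bundle V E c b" and b: "b \<ge> 1"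
    and "partial_partition c b P p h K"
  shows "\<exists>p h K. partial_partition c b V p h K"
  using assms(3)
proof (induction "card (V - P)" arbitrary: P p h K rule: less_induct)
  case less
  show ?case
  proof (cases "P = V")
    case False
    obtain P' p' K' where P': "P \<subset> P'" "partial_partition c b P' p' (Suc h) K'"
      using partial_partition_extend[OF nb b less.prems False] .
    then have "V - P' \<subset> V - P" using partial_partitionD(1)[OF P'(2)] by blast
    then have "card (V - P') < card (V - P)" using finite_V by (intro psubset_card_mono) auto
    then show ?thesis using less.hyps P'(2) by blast
  qed (use less.prems in blast)
qed

text \<open>In the order of their creation, the parts form an elimination ordering of the quotient:
  each has at most \<open>c\<close> earlier neighbours, and these form a clique.\<close>

lemma tpw_le_part_bound:
  assumes nb: "\<not> has_bundle V E c b" and b: "b \<ge> 1"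
  shows "tpw c V E \<le> part_bound b"
proof -
  have "partial_partition c b {} (\<lambda>_. 0) 0 (\<lambda>_. {})"
    by (simp add: partial_partition_def attach_def clique_of_def)
  then obtain p h K where pp: "partial_partition c b V p h K"
    using partial_partition_complete[OF nb b] by blast
  then have ph: "\<And>v. v \<in> V \<Longrightarrow> p v < h"
    and K: "\<And>i. i < h \<Longrightarrow> K i \<subseteq> {..<i} \<and> card (K i) \<le> c \<and> clique_of K (K i)"
    and edges: "\<And>u v. u \<in> V \<Longrightarrow> v \<in> V \<Longrightarrow> {u, v} \<in> E \<Longrightarrow> p u = p v \<or> p u \<in> K (p v) \<or> p v \<in> K (p u)"
    and wid: "\<And>i. card {v \<in> V. p v = i} \<le> part_bound b"
    using partial_partitionD[OF pp] by metis+
  define F where "F = {{i, j} | i j. j < h \<and> i \<in> K j}"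
  have gF: "graph {..<h} F"
    unfolding graph_def F_def using K by fastforce
  have "treewidth {..<h} F \<le> c"
  proof (rule treewidth_le_chordal[OF gF, where K = K and rk = id])
    show "K v \<subseteq> {..<h}" "card (K v) \<le> c" if "v \<in> {..<h}" for v
      using K[of v] that by fastforce+
    show "id u < id v" if "v \<in> {..<h}" "u \<in> K v" for u v
      using K[of v] that by fastforce
    show "u \<in> K u' \<or> u' \<in> K u" if "v \<in> {..<h}" "u \<in> K v" "u' \<in> K v" "u \<noteq> u'" for u u' v
      using K[of v] that unfolding clique_of_def by (metis lessThan_iff nat_neq_iff)
    show "u \<in> K v \<or> v \<in> K u" if "{u, v} \<in> F" for u v
      using that by (auto simp: F_def doubleton_eq_iff)
  qed
  moreover have "H_partition_width_le V E {..<h} F p (part_bound b)"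
    unfolding H_partition_width_le_def
  proof (intro conjI ballI allI impI)
    fix u v assume uv: "{u, v} \<in> E"
    have "u \<in> V" "v \<in> V" using graph_edge[OF graph uv] by auto
    then show "p u = p v \<or> {p u, p v} \<in> F"
      using edges[OF _ _ uv] ph[of u] ph[of v] by (auto simp: F_def insert_commute)
  qed (use ph wid in auto)
  ultimately show ?thesis using H_partition_tpw_le[OF gF] by blast
qed

end

text \<open>Since \<open>b\<close> is the same throughout the class, \<open>part_bound\<close>
  depends on the treewidth alone.\<close>

lemma bounded_if_no_bundle:
  assumes "b \<ge> 1" and "\<And>V E. (V, E) \<in> \<G> \<Longrightarrow> graph V E \<and> \<not> has_bundle V E c b"
  shows "tpw_bounded_by_tw \<G> c"
proof -
  define f where "f k = (k + 1) * (2 * (2 ^ (2 * (k + 1)) * b + 2 * (k + 1) + 1))" for k :: nat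
  have "tpw c V E \<le> f (treewidth V E)" if G: "(V, E) \<in> \<G>" for V E
  proof -
    obtain T r par rk bag where "rooted_decomp T r par rk V E bag (treewidth V E)"
      using rooted_decomp_exists assms(2)[OF G] by blast
    then interpret rooted_decomp T r par rk V E bag "treewidth V E" .
    show ?thesis using tpw_le_part_bound assms(1) assms(2)[OF G] by (simp add: part_bound_def f_def)
  qed
  then show ?thesis unfolding tpw_bounded_by_tw_def by blast
qed

section \<open>Bundles and subdivided complete graphs\<close>

lemma set_interior:
  assumes "distinct xs" "length xs \<ge> 2"
  shows "set (butlast (tl xs)) = set xs - {hd xs, last xs}"
proof -
  obtain x ys where xs: "xs = x # ys" using assms(2) by (cases xs) auto
  then have "ys \<noteq> []" using assms(2) by auto
  then obtain zs z where "ys = zs @ [z]" by (metis append_butlast_last_id)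
  then show ?thesis using xs assms(1) by auto
qed

text \<open>Disjoint vertex sets stand in for paths: reachability through \<open>I i j\<close>
  yields a repetition-free path with interior in \<open>I i j\<close>.\<close>

lemma has_Kt_top_minorI:
  assumes b: "inj_on b {..<t}" "b ` {..<t} \<subseteq> V"
    and conn: "\<And>i j. i < j \<Longrightarrow> j < t \<Longrightarrow> reach (insert (b i) (insert (b j) (I i j))) E (b i) (b j)"
    and bI: "\<And>i j. i < j \<Longrightarrow> j < t \<Longrightarrow> I i j \<inter> b ` {..<t} = {}"
    and disj: "\<And>i j i' j'. i < j \<Longrightarrow> j < t \<Longrightarrow> i' < j' \<Longrightarrow> j' < t \<Longrightarrow> (i, j) \<noteq> (i', j') \<Longrightarrow>
      I i j \<inter> I i' j' = {}"
  shows "has_Kt_top_minor t V E"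
proof -
  have "\<exists>xs. length xs \<ge> 2 \<and> distinct xs \<and> hd xs = b i \<and> last xs = b j \<and> walk E xs \<and>
      set (butlast (tl xs)) \<subseteq> I i j" if ij: "i < j" "j < t" for i j
  proof -
    obtain xs where xs: "xs \<noteq> []" "distinct xs" "hd xs = b i" "last xs = b j" "walk E xs"
      "set xs \<subseteq> insert (b i) (insert (b j) (I i j))"
      using reach_path[OF conn[OF ij]] by blast
    have "b i \<noteq> b j" using b(1) ij by (auto simp: inj_on_def)
    then have "length xs \<ge> 2" using xs by (cases xs) (auto simp: Suc_le_eq split: if_splits)
    then show ?thesis using xs set_interior[of xs] by (intro exI[of _ xs]) auto
  qed
  then obtain P where P: "\<And>i j. i < j \<Longrightarrow> j < t \<Longrightarrow> length (P i j) \<ge> 2 \<and> distinct (P i j) \<and>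
      hd (P i j) = b i \<and> last (P i j) = b j \<and> walk E (P i j) \<and> set (butlast (tl (P i j))) \<subseteq> I i j"
    by metis
  show ?thesis unfolding has_Kt_top_minor_def
  proof (intro exI conjI allI impI)
    show "inj_on b {..<t}" "b ` {..<t} \<subseteq> V" by (rule b)+
    fix i j assume ij: "i < j \<and> j < t"
    then show "length (P i j) \<ge> 2" "distinct (P i j)" "hd (P i j) = b i" "last (P i j) = b j"
      using P by auto
    show "{P i j ! k, P i j ! Suc k} \<in> E" if "Suc k < length (P i j)" for k
      using P ij that by (auto simp: walk_nth)
    show "set (butlast (tl (P i j))) \<inter> b ` {..<t} = {}" using P[of i j] bI[of i j] ij by blast
  next
    fix i j i' j' assume "i < j \<and> j < t \<and> i' < j' \<and> j' < t \<and> (i, j) \<noteq> (i', j')"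
    then show "set (butlast (tl (P i j))) \<inter> set (butlast (tl (P i' j'))) = {}"
      using P[of i j] P[of i' j'] disj[of i j i' j'] by blast
  qed
qed

text \<open>\<open>J\<close> gives the interiors of the paths, indexed symmetrically so that pairs
  of branch vertices can be treated as unordered.\<close>

lemma has_Kt_top_minorE:
  assumes "has_Kt_top_minor t V E"
  obtains b J where "inj_on b {..<t}" "b ` {..<t} \<subseteq> V"
    "\<And>i j. i < t \<Longrightarrow> j < t \<Longrightarrow> i \<noteq> j \<Longrightarrow> reach (insert (b i) (insert (b j) (J i j))) E (b i) (b j)"
    "\<And>i j. J i j = J j i"
    "\<And>i j. i < t \<Longrightarrow> j < t \<Longrightarrow> i \<noteq> j \<Longrightarrow> J i j \<inter> b ` {..<t} = {}"
    "\<And>i j i' j'. i < t \<Longrightarrow> j < t \<Longrightarrow> i \<noteq> j \<Longrightarrow> i' < t \<Longrightarrow> j' < t \<Longrightarrow> i' \<noteq> j' \<Longrightarrow> {i, j} \<noteq> {i', j'} \<Longrightarrow>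
      J i j \<inter> J i' j' = {}"
proof -
  obtain b P where d: "inj_on b {..<t} \<and> b ` {..<t} \<subseteq> V
        \<and> (\<forall>i j. i < j \<and> j < t \<longrightarrow>
              length (P i j) \<ge> 2 \<and> distinct (P i j)
              \<and> hd (P i j) = b i \<and> last (P i j) = b j
              \<and> (\<forall>k. Suc k < length (P i j) \<longrightarrow> {P i j ! k, P i j ! Suc k} \<in> E)
              \<and> set (butlast (tl (P i j))) \<inter> b ` {..<t} = {})
        \<and> (\<forall>i j i' j'. i < j \<and> j < t \<and> i' < j' \<and> j' < t \<and> (i, j) \<noteq> (i', j') \<longrightarrow>
              set (butlast (tl (P i j))) \<inter> set (butlast (tl (P i' j'))) = {})"
    using assms unfolding has_Kt_top_minor_def by (elim exE) (rule that)
  have b: "inj_on b {..<t}" "b ` {..<t} \<subseteq> V" using conjunct1[OF d] conjunct1[OF conjunct2[OF d]] .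
  note P = conjunct1[OF conjunct2[OF conjunct2[OF d]], rule_format]
  note disj = conjunct2[OF conjunct2[OF conjunct2[OF d]], rule_format]
  define J where "J i j = set (butlast (tl (P (min i j) (max i j))))" for i j
  have conn: "reach (insert (b i) (insert (b j) (J i j))) E (b i) (b j)" if ij: "i < j" "j < t" for i j
  proof -
    have p: "length (P i j) \<ge> 2" "distinct (P i j)" "hd (P i j) = b i" "last (P i j) = b j" "walk E (P i j)"
      using P[of i j] ij by (auto simp: walk_nth)
    then have "P i j \<noteq> []" by auto
    then have "reach (set (P i j)) E (b i) (b j)" using walk_reach[OF p(5)] p by simp
    moreover have "set (P i j) \<subseteq> insert (b i) (insert (b j) (J i j))"
      using set_interior[of "P i j"] p ij by (auto simp: J_def min_def max_def)
    ultimately show ?thesis by (rule reach_mono) simp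
  qed
  show ?thesis
  proof (rule that[OF b, of J])
    show sym: "J i j = J j i" for i j by (simp add: J_def min.commute max.commute)
    show "reach (insert (b i) (insert (b j) (J i j))) E (b i) (b j)"
      if "i < t" "j < t" "i \<noteq> j" for i j
    proof (cases "i < j")
      case True
      then show ?thesis using conn that by blast
    next
      case False
      then have "reach (insert (b j) (insert (b i) (J j i))) E (b j) (b i)" using conn that by simp
      then show ?thesis using sym[of i j] by (simp add: reach_sym insert_commute)
    qed
    show "J i j \<inter> b ` {..<t} = {}" if "i < t" "j < t" "i \<noteq> j" for i j
      using P[of "min i j" "max i j"] that by (auto simp: J_def min_def max_def)
    show "J i j \<inter> J i' j' = {}"
      if "i < t" "j < t" "i \<noteq> j" "i' < t" "j' < t" "i' \<noteq> j'" "{i, j} \<noteq> {i', j'}" for i j i' j'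
      unfolding J_def by (rule disj) (use that in \<open>auto simp: min_def max_def\<close>)
  qed
qed

lemma reach_through:
  assumes "connected_on C E" "u \<in> C" "v \<in> C" "{u, a} \<in> E" "{v, a'} \<in> E" "C \<subseteq> S" "a \<in> S" "a' \<in> S"
  shows "reach S E a a'"
proof -
  have "reach S E u v"
    using assms(1-3,6) by (auto simp: connected_on_reach intro: reach_mono)
  moreover have "reach S E a u" "reach S E v a'"
    using assms by (auto intro: reach_edge reach_sym)
  ultimately show ?thesis by (blast intro: reach_trans)
qed

lemma has_bundleE:
  assumes "has_bundle V E c b"
  obtains X B D where "X \<subseteq> V" "connected_on X E" "B \<subseteq> V" "B \<inter> X = {}" "card B = c"
    "card D = b" "pairwise disjnt D"
    "\<And>C. C \<in> D \<Longrightarrow> C \<subseteq> X \<and> C \<noteq> {} \<and> connected_on C E \<and> (\<forall>v\<in>B. \<exists>u\<in>C. {u, v} \<in> E)"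
proof -
  obtain X B D where d: "X \<subseteq> V \<and> connected_on X E \<and> B \<subseteq> V \<and> B \<inter> X = {} \<and> card B = c \<and>
      card D = b \<and> pairwise disjnt D \<and>
      (\<forall>C\<in>D. C \<subseteq> X \<and> C \<noteq> {} \<and> connected_on C E \<and> (\<forall>v\<in>B. \<exists>u\<in>C. {u, v} \<in> E))"
    using assms unfolding has_bundle_def by (elim exE) (rule that)
  show ?thesis by (rule that[of X B D]) (use d in simp_all)
qed

lemma ex_nat_enumeration:
  assumes "card A = n" "n > 0"
  obtains f :: "nat \<Rightarrow> 'a" where "inj_on f {..<n}" "f ` {..<n} = A"
proof -
  have "finite A" using assms card_gt_0_iff[of A] by simp
  then obtain f where "bij_betw f {0..<card A} A" using ex_bij_betw_nat_finite by blast
  then show ?thesis using that[of f] assms(1) by (simp add: bij_betw_def lessThan_atLeast0)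
qed

text \<open>The vertices of \<open>B\<close> become branch vertices, and each pair
  \<open>i < j\<close> is joined through its own piece, numbered \<open>i * t + j\<close>.\<close>

lemma no_bundle_general:
  assumes t: "t \<ge> 1" and no: "\<not> has_Kt_top_minor t V E"
  shows "\<not> has_bundle V E t (t * t)"
proof
  assume "has_bundle V E t (t * t)"
  then obtain X B D where X: "X \<subseteq> V" "connected_on X E" "B \<subseteq> V" "B \<inter> X = {}" "card B = t"
      "card D = t * t" "pairwise disjnt D"
    and D: "\<And>C. C \<in> D \<Longrightarrow> C \<subseteq> X \<and> C \<noteq> {} \<and> connected_on C E \<and> (\<forall>v\<in>B. \<exists>u\<in>C. {u, v} \<in> E)"
    by (elim has_bundleE) (rule that)
  obtain b where b: "inj_on b {..<t}" "b ` {..<t} = B"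
    using ex_nat_enumeration[OF X(5)] t by auto
  obtain C where C: "inj_on C {..<t * t}" "C ` {..<t * t} = D"
    using ex_nat_enumeration[OF X(6)] t by auto
  have ix: "i * t + j < t * t" if "i < t" "j < t" for i j :: nat
  proof -
    have "i * t + j < Suc i * t" using that by simp
    also have "\<dots> \<le> t * t" using that by (intro mult_le_mono1) simp
    finally show ?thesis .
  qed
  have CD: "C (i * t + j) \<in> D" if "i < t" "j < t" for i j
    using C(2) ix[OF that] by blast
  have "has_Kt_top_minor t V E"
  proof (rule has_Kt_top_minorI[where b = b and I = "\<lambda>i j. C (i * t + j)"])
    show "inj_on b {..<t}" "b ` {..<t} \<subseteq> V" using b X by auto
    fix i j :: nat assume ij: "i < j" "j < t"
    then have CDij: "C (i * t + j) \<in> D" using CD by simp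
    show "C (i * t + j) \<inter> b ` {..<t} = {}" using D[OF CDij] X(4) b(2) by blast
    have "b i \<in> B" "b j \<in> B" using b ij by auto
    then obtain u v where "u \<in> C (i * t + j)" "{u, b i} \<in> E" "v \<in> C (i * t + j)" "{v, b j} \<in> E"
      using D[OF CDij] by blast
    then show "reach (insert (b i) (insert (b j) (C (i * t + j)))) E (b i) (b j)"
      using D[OF CDij] by (intro reach_through[of "C (i * t + j)"]) auto
    fix i' j' :: nat assume ij': "i' < j'" "j' < t" "(i, j) \<noteq> (i', j')"
    have "i * t + j \<noteq> i' * t + j'"
    proof
      assume eq: "i * t + j = i' * t + j'"
      have "(i * t + j) div t = i" "(i' * t + j') div t = i'"
        "(i * t + j) mod t = j" "(i' * t + j') mod t = j'" using ij ij' by auto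
      then show False using eq ij'(3) by metis
    qed
    then have "C (i * t + j) \<noteq> C (i' * t + j')"
      using C(1) ix[of i j] ix[of i' j'] ij ij' by (auto simp: inj_on_def)
    then show "C (i * t + j) \<inter> C (i' * t + j') = {}"
      using X(7) CDij CD[of i' j'] ij' by (simp add: pairwise_def disjnt_def)
  qed
  then show False using no by blast
qed

text \<open>Vertices of two disjoint pieces are joined by a path in the connected set
  \<open>X\<close>, which is a subdivided edge.\<close>

lemma no_bundle_2:
  assumes "\<not> has_Kt_top_minor 2 V E"
  shows "\<not> has_bundle V E 0 2"
proof
  assume "has_bundle V E 0 2"
  then obtain X B D where X: "X \<subseteq> V" "connected_on X E" "card D = 2" "pairwise disjnt D"
    and D: "\<And>C. C \<in> D \<Longrightarrow> C \<subseteq> X \<and> C \<noteq> {} \<and> connected_on C E \<and> (\<forall>v\<in>B. \<exists>u\<in>C. {u, v} \<in> E)"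
    by (elim has_bundleE) (rule that)
  obtain C C' where CC: "C \<in> D" "C' \<in> D" "C \<noteq> C'" using X(3) by (auto simp: card_2_iff)
  then have "disjnt C C'" using X(4) by (simp add: pairwise_def)
  moreover obtain u u' where u: "u \<in> C" "u' \<in> C'" using D CC by blast
  ultimately have uu: "u \<in> X" "u' \<in> X" "u \<noteq> u'" using D CC by (auto simp: disjnt_iff)
  have "has_Kt_top_minor 2 V E"
  proof (rule has_Kt_top_minorI[where b = "\<lambda>i. if i = 0 then u else u'" and I = "\<lambda>i j. X - {u, u'}"])
    show "inj_on (\<lambda>i::nat. if i = 0 then u else u') {..<2}" using uu by (auto simp: inj_on_def)
    show "(\<lambda>i. if i = 0 then u else u') ` {..<2} \<subseteq> V" using uu X by auto
    fix i j :: nat assume ij: "i < j" "j < 2"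
    then have [simp]: "i = 0" "j = 1" by auto
    have "insert u (insert u' (X - {u, u'})) = X" using uu by auto
    then show "reach (insert (if i = 0 then u else u') (insert (if j = 0 then u else u') (X - {u, u'}))) E
        (if i = 0 then u else u') (if j = 0 then u else u')"
      using X(2) uu by (simp add: connected_on_reach)
    show "(X - {u, u'}) \<inter> (\<lambda>i. if i = 0 then u else u') ` {..<2} = {}" by auto
  next
    fix i j i' j' :: nat
    assume "i < j" "j < 2" "i' < j'" "j' < 2" "(i, j) \<noteq> (i', j')"
    then show "(X - {u, u'}) \<inter> (X - {u, u'}) = {}" by auto
  qed
  then show False using assms by blast
qed

text \<open>The outside vertex \<open>w\<close> has neighbours in two disjoint pieces, and a path
  between them in \<open>X\<close> closes a cycle through \<open>w\<close>.\<close>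

lemma no_bundle_3:
  assumes "\<not> has_Kt_top_minor 3 V E"
  shows "\<not> has_bundle V E 1 2"
proof
  assume "has_bundle V E 1 2"
  then obtain X B D where X: "X \<subseteq> V" "connected_on X E" "B \<subseteq> V" "B \<inter> X = {}" "card B = 1"
      "card D = 2" "pairwise disjnt D"
    and D: "\<And>C. C \<in> D \<Longrightarrow> C \<subseteq> X \<and> C \<noteq> {} \<and> connected_on C E \<and> (\<forall>v\<in>B. \<exists>u\<in>C. {u, v} \<in> E)"
    by (elim has_bundleE) (rule that)
  obtain w where w: "B = {w}" using X(5) by (auto simp: card_1_singleton_iff)
  obtain C C' where CC: "C \<in> D" "C' \<in> D" "C \<noteq> C'" using X(6) by (auto simp: card_2_iff)
  then have "disjnt C C'" using X(7) by (simp add: pairwise_def)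
  moreover obtain u u' where u: "u \<in> C" "u' \<in> C'" "{u, w} \<in> E" "{u', w} \<in> E"
    using D CC w by blast
  ultimately have uu: "u \<in> X" "u' \<in> X" "u \<noteq> u'" using D CC by (auto simp: disjnt_iff)
  have wX: "w \<notin> X" "w \<in> V" using X w by auto
  define b where "b i = (if i = 0 then w else if i = 1 then u else u')" for i :: nat
  define I where "I i j = (if i = 0 then {} else X - {u, u'})" for i j :: nat
  have "has_Kt_top_minor 3 V E"
  proof (rule has_Kt_top_minorI[where b = b and I = I])
    show "inj_on b {..<3}" using uu wX by (auto simp: inj_on_def b_def)
    show "b ` {..<3} \<subseteq> V" using uu X wX by (auto simp: b_def)
    fix i j :: nat assume ij: "i < j" "j < 3"
    show "I i j \<inter> b ` {..<3} = {}" using wX by (auto simp: I_def b_def)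
    consider "i = 0" "j = 1" | "i = 0" "j = 2" | "i = 1" "j = 2" using ij by linarith
    then show "reach (insert (b i) (insert (b j) (I i j))) E (b i) (b j)"
    proof cases
      case 3
      have "insert u (insert u' (X - {u, u'})) = X" using uu by auto
      then show ?thesis using X(2) uu 3 by (simp add: connected_on_reach b_def I_def)
    qed (use u in \<open>auto intro!: reach_edge simp: b_def I_def insert_commute\<close>)
  next
    fix i j i' j' :: nat
    assume "i < j" "j < 3" "i' < j'" "j' < 3" "(i, j) \<noteq> (i', j')"
    then show "I i j \<inter> I i' j' = {}" by (auto simp: I_def)
  qed
  then show False using assms by blast
qed

lemma walk_appendD: "walk E (xs @ ys) \<Longrightarrow> walk E xs" "walk E (xs @ ys) \<Longrightarrow> walk E ys"
  by (auto simp: walk_def successively_append_iff)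

text \<open>A shortest walk in \<open>X\<close> between two different sets has the required
  interior: a vertex of it in some \<open>A l\<close> would allow cutting the walk there, as
  \<open>l\<close> differs from \<open>i\<close> or from \<open>j\<close>.\<close>

lemma connecting_walk:
  assumes X: "connected_on X E"
    and A: "\<And>i. i \<in> S \<Longrightarrow> A i \<subseteq> X \<and> A i \<noteq> {}"
    and disj: "\<And>i j. i \<in> S \<Longrightarrow> j \<in> S \<Longrightarrow> i \<noteq> j \<Longrightarrow> A i \<inter> A j = {}"
    and S: "i0 \<in> S" "j0 \<in> S" "i0 \<noteq> j0"
  obtains i j x y Z where "i \<in> S" "j \<in> S" "i \<noteq> j" "x \<in> A i" "y \<in> A j" "Z \<subseteq> X"
    "Z \<inter> (\<Union>i\<in>S. A i) = {}" "reach (insert x (insert y Z)) E x y"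
proof -
  define Q where "Q xs \<longleftrightarrow> xs \<noteq> [] \<and> walk E xs \<and> set xs \<subseteq> X \<and>
    (\<exists>i\<in>S. \<exists>j\<in>S. i \<noteq> j \<and> hd xs \<in> A i \<and> last xs \<in> A j)" for xs
  obtain u v where "u \<in> A i0" "v \<in> A j0" using A S by blast
  moreover from this have "reach X E u v" "u \<in> X" using X A S by (auto simp: connected_on_reach)
  ultimately have "\<exists>xs. Q xs" using S unfolding Q_def by (metis reach_path)
  then obtain xs where xs: "Q xs" "\<And>ys. Q ys \<Longrightarrow> length xs \<le> length ys"
    using ex_has_least_nat[of Q _ length] by blast
  then obtain i j where ij: "i \<in> S" "j \<in> S" "i \<noteq> j" "hd xs \<in> A i" "last xs \<in> A j"
    and xs': "xs \<noteq> []" "walk E xs" "set xs \<subseteq> X"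
    by (auto simp: Q_def)
  have "hd xs \<noteq> last xs" using ij disj[OF ij(1-3)] by auto
  then have "tl xs \<noteq> []" using xs'(1) by (cases xs) auto
  then obtain x ms y where xms: "xs = x # ms @ [y]"
    using xs'(1) by (metis append_butlast_last_id list.collapse)
  have "set ms \<inter> (\<Union>i\<in>S. A i) = {}"
  proof (rule ccontr)
    assume "set ms \<inter> (\<Union>i\<in>S. A i) \<noteq> {}"
    then obtain z l where z: "z \<in> set ms" "l \<in> S" "z \<in> A l" by blast
    then obtain as cs where ms: "ms = as @ z # cs" by (meson split_list)
    have "xs = (x # as @ [z]) @ (cs @ [y])" "xs = (x # as) @ (z # cs @ [y])"
      by (simp_all add: xms ms)
    then have w: "walk E (x # as @ [z])" "walk E (z # cs @ [y])"
      using xs'(2) walk_appendD by metis+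
    have "Q (x # as @ [z])" if "l \<noteq> i"
    proof -
      have "hd (x # as @ [z]) \<in> A i" "last (x # as @ [z]) \<in> A l" using ij z by (simp_all add: xms)
      then have "\<exists>i\<in>S. \<exists>j\<in>S. i \<noteq> j \<and> hd (x # as @ [z]) \<in> A i \<and> last (x # as @ [z]) \<in> A j"
        using ij(1) z(2) that by metis
      moreover have "set (x # as @ [z]) \<subseteq> X" using xs' by (auto simp: xms ms)
      ultimately show ?thesis using w by (simp add: Q_def)
    qed
    moreover have "Q (z # cs @ [y])" if "l \<noteq> j"
    proof -
      have "hd (z # cs @ [y]) \<in> A l" "last (z # cs @ [y]) \<in> A j" using ij z by (simp_all add: xms)
      then have "\<exists>i\<in>S. \<exists>j\<in>S. i \<noteq> j \<and> hd (z # cs @ [y]) \<in> A i \<and> last (z # cs @ [y]) \<in> A j"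
        using ij(2) z(2) that by metis
      moreover have "set (z # cs @ [y]) \<subseteq> X" using xs' by (auto simp: xms ms)
      ultimately show ?thesis using w by (simp add: Q_def)
    qed
    ultimately have "Q (x # as @ [z]) \<or> Q (z # cs @ [y])" using ij(3) by blast
    then show False using xs(2) by (fastforce simp: xms ms)
  qed
  moreover have "reach (insert x (insert y (set ms))) E x y"
    using walk_reach[OF xs'(2,1)] by (simp add: xms insert_commute)
  ultimately show ?thesis
    using that[of i j x y "set ms"] ij xs' by (auto simp: xms)
qed

lemma pairs_less_4:
  fixes i j :: nat
  assumes "i < j" "j < 4"
  shows "(i, j) \<in> {(0, 1), (0, 2), (0, 3), (1, 2), (1, 3), (2, 3)}"
proof -
  have "j = 1 \<or> j = 2 \<or> j = 3" using assms by arith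
  moreover have "i = 0 \<or> i = 1 \<or> i = 2" using assms by arith
  ultimately show ?thesis using assms(1) by auto
qed

text \<open>The three pieces give three disjoint paths between \<open>w\<close> and
  \<open>w'\<close>. As \<open>X\<close> is connected, \<open>connecting_walk\<close> joins two of
  them, from \<open>x\<close> to \<open>y\<close>, off the third. The branch vertices are
  \<open>w\<close>, \<open>w'\<close>, \<open>x\<close> and \<open>y\<close>.\<close>

lemma no_bundle_4:
  assumes "\<not> has_Kt_top_minor 4 V E"
  shows "\<not> has_bundle V E 2 3"
proof
  assume "has_bundle V E 2 3"
  then obtain X B D where X: "X \<subseteq> V" "connected_on X E" "B \<subseteq> V" "B \<inter> X = {}" "card B = 2"
      "card D = 3" "pairwise disjnt D"
    and D: "\<And>C. C \<in> D \<Longrightarrow> C \<subseteq> X \<and> C \<noteq> {} \<and> connected_on C E \<and> (\<forall>v\<in>B. \<exists>u\<in>C. {u, v} \<in> E)"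
    by (elim has_bundleE) (rule that)
  obtain w w' where w: "B = {w, w'}" "w \<noteq> w'" using X(5) by (auto simp: card_2_iff)
  have dj: "C \<inter> C' = {}" if "C \<in> D" "C' \<in> D" "C \<noteq> C'" for C C'
    using X(7) that by (simp add: pairwise_def disjnt_def)
  have "\<exists>xs. xs \<noteq> [] \<and> distinct xs \<and> walk E xs \<and> set xs \<subseteq> C \<and> {hd xs, w} \<in> E \<and> {last xs, w'} \<in> E"
    if "C \<in> D" for C
  proof -
    obtain u u' where "u \<in> C" "u' \<in> C" "{u, w} \<in> E" "{u', w'} \<in> E" using D[OF \<open>C \<in> D\<close>] w by blast
    moreover from this have "reach C E u u'" using D[OF \<open>C \<in> D\<close>] by (simp add: connected_on_reach)
    ultimately show ?thesis by (metis reach_path)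
  qed
  then obtain P where P: "\<And>C. C \<in> D \<Longrightarrow> P C \<noteq> [] \<and> distinct (P C) \<and> walk E (P C) \<and> set (P C) \<subseteq> C \<and>
      {hd (P C), w} \<in> E \<and> {last (P C), w'} \<in> E" by metis
  obtain C0 C1 where C01: "C0 \<in> D" "C1 \<in> D" "C0 \<noteq> C1"
    using X(6) by (auto simp: numeral_3_eq_3 card_Suc_eq)
  have PX: "set (P C) \<subseteq> X \<and> set (P C) \<noteq> {}" if "C \<in> D" for C
    using P[OF that] D[OF that] by auto
  have Pdj: "set (P C) \<inter> set (P C') = {}" if "C \<in> D" "C' \<in> D" "C \<noteq> C'" for C C'
    using P[OF that(1)] P[OF that(2)] dj[OF that] by blast
  obtain C C' x y Z where C: "C \<in> D" "C' \<in> D" "C \<noteq> C'" "x \<in> set (P C)" "y \<in> set (P C')"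
    and Z: "Z \<subseteq> X" "Z \<inter> (\<Union>C\<in>D. set (P C)) = {}" "reach (insert x (insert y Z)) E x y"
  proof (rule connecting_walk[where A = "\<lambda>C. set (P C)", OF X(2) PX Pdj C01])
    fix i j x y Z
    assume "i \<in> D" "j \<in> D" "i \<noteq> j" "x \<in> set (P i)" "y \<in> set (P j)" "Z \<subseteq> X"
      "Z \<inter> (\<Union>C\<in>D. set (P C)) = {}" "reach (insert x (insert y Z)) E x y"
    then show thesis by (rule that)
  qed
  have "card (D - {C, C'}) = 1" using C X(6) by (simp add: card_Diff_subset)
  then obtain C'' where C'': "C'' \<in> D" "C'' \<noteq> C" "C'' \<noteq> C'" by (auto simp: card_1_singleton_iff)
  \<comment> \<open>The first halves \<open>a1\<close>, \<open>c1\<close> lead to \<open>w\<close>,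
    the second halves \<open>a2\<close>, \<open>c2\<close> to \<open>w'\<close>.\<close>
  obtain a1 a2 where a: "P C = a1 @ x # a2" using C(4) by (meson split_list)
  obtain c1 c2 where c: "P C' = c1 @ y # c2" using C(5) by (meson split_list)
  define Y where "Y = set (P C'')"
  have sub: "set a1 \<subseteq> C" "set a2 \<subseteq> C" "x \<in> C" "set c1 \<subseteq> C'" "set c2 \<subseteq> C'" "y \<in> C'" "Y \<subseteq> C''"
    using P[OF C(1)] P[OF C(2)] P[OF C''(1)] a c by (auto simp: Y_def)
  have dist: "distinct (a1 @ x # a2)" "distinct (c1 @ y # c2)"
    using P[OF C(1)] P[OF C(2)] a c by auto
  have cdj: "C \<inter> C' = {}" "C \<inter> C'' = {}" "C' \<inter> C'' = {}" using dj C C'' by auto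
  have CX: "C \<subseteq> X" "C' \<subseteq> X" "C'' \<subseteq> X" using D C C'' by auto
  have wX: "w \<notin> X" "w' \<notin> X" "w \<in> V" "w' \<in> V" using X w by auto
  have Zd: "Z \<inter> set a1 = {}" "Z \<inter> set a2 = {}" "x \<notin> Z" "Z \<inter> set c1 = {}" "Z \<inter> set c2 = {}" "y \<notin> Z" "Z \<inter> Y = {}"
  proof -
    have "Z \<inter> set (P C) = {}" "Z \<inter> set (P C') = {}" "Z \<inter> set (P C'') = {}"
      using Z(2) C(1,2) C''(1) by blast+
    then show "Z \<inter> set a1 = {}" "Z \<inter> set a2 = {}" "x \<notin> Z" "Z \<inter> set c1 = {}" "Z \<inter> set c2 = {}"
      "y \<notin> Z" "Z \<inter> Y = {}"
      unfolding a c Y_def by auto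
  qed
  have left: "reach (insert w (insert z (set zs))) E w z"
    if "walk E (zs @ z # zs')" "{hd (zs @ z # zs'), w} \<in> E" for z zs zs'
  proof -
    have "walk E (zs @ [z])" using that(1) by (auto simp: walk_def successively_append_iff)
    then have "reach (set (zs @ [z])) E (hd (zs @ [z])) z" using walk_reach[of E "zs @ [z]"] by simp
    then have "reach (insert w (insert z (set zs))) E (hd (zs @ [z])) z"
      by (rule reach_mono) auto
    moreover have "reach (insert w (insert z (set zs))) E w (hd (zs @ [z]))"
      using that(2) by (intro reach_edge) (cases zs; auto simp: insert_commute)+
    ultimately show ?thesis by (blast intro: reach_trans)
  qed
  have right: "reach (insert w' (insert z (set zs'))) E w' z"
    if "walk E (zs @ z # zs')" "{last (zs @ z # zs'), w'} \<in> E" for z zs zs'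
  proof -
    have "walk E (z # zs')" using that(1) by (auto simp: walk_def successively_append_iff)
    then have "reach (set (z # zs')) E z (last (z # zs'))" using walk_reach[of E "z # zs'"] by simp
    then have "reach (insert w' (insert z (set zs'))) E z (last (z # zs'))"
      by (rule reach_mono) auto
    moreover have "reach (insert w' (insert z (set zs'))) E (last (z # zs')) w'"
      using that(2) by (intro reach_edge) auto
    ultimately show ?thesis by (blast intro: reach_trans reach_sym)
  qed
  define b where "b i = (if i = 0 then w else if i = 1 then w' else if i = 2 then x else y)" for i :: nat
  \<comment> \<open>Since \<open>i < j\<close>, the test \<open>j = 1\<close> singles out the pair
    \<open>w\<close>, \<open>w'\<close>, joined by the third path. The final \<open>Z\<close> serves
    the pair \<open>x\<close>, \<open>y\<close>.\<close>
  define I where "I i j = (if j = 1 then Y else if i = 0 then (if j = 2 then set a1 else set c1)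
    else if i = 1 then (if j = 2 then set a2 else set c2) else Z)" for i j :: nat
  have lt4: "{..<4} = {0, 1, 2, 3 :: nat}" by auto
  have b4: "b ` {..<4} = {w, w', x, y}" unfolding lt4 by (auto simp: b_def)
  have "has_Kt_top_minor 4 V E"
  proof (rule has_Kt_top_minorI[where b = b and I = I])
    have "w \<noteq> x" "w \<noteq> y" "w' \<noteq> x" "w' \<noteq> y" "x \<noteq> y" using wX sub CX cdj by auto
    then show "inj_on b {..<4}" unfolding lt4 using w(2) by (simp add: b_def)
    show "b ` {..<4} \<subseteq> V" unfolding b4 using wX sub CX X(1) by blast
    fix i j :: nat assume ij: "i < j" "j < 4"
    then consider "i = 0" "j = 1" | "i = 0" "j = 2" | "i = 0" "j = 3" | "i = 1" "j = 2"
      | "i = 1" "j = 3" | "i = 2" "j = 3" using pairs_less_4 by blast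
    note cases = this
    from cases show "I i j \<inter> b ` {..<4} = {}" unfolding b4
      by cases (use wX sub CX cdj dist Zd Z(1) in \<open>auto simp: I_def\<close>)
    from cases show "reach (insert (b i) (insert (b j) (I i j))) E (b i) (b j)"
    proof cases
      case 1
      have "walk E (P C'')" "P C'' \<noteq> []" using P[OF C''(1)] by auto
      then have "reach Y E (hd (P C'')) (last (P C''))" using walk_reach by (simp add: Y_def)
      then have "reach (insert w (insert w' Y)) E (hd (P C'')) (last (P C''))"
        by (rule reach_mono) auto
      moreover have "reach (insert w (insert w' Y)) E w (hd (P C''))"
        "reach (insert w (insert w' Y)) E (last (P C'')) w'"
        using P[OF C''(1)] by (auto simp: Y_def insert_commute intro!: reach_edge)
      ultimately show ?thesis using 1 by (auto simp: b_def I_def intro: reach_trans)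
    next
      case 2
      then show ?thesis using left[of a1 x a2] P[OF C(1)] a by (simp add: b_def I_def)
    next
      case 3
      then show ?thesis using left[of c1 y c2] P[OF C(2)] c by (simp add: b_def I_def)
    next
      case 4
      then show ?thesis using right[of a1 x a2] P[OF C(1)] a by (simp add: b_def I_def)
    next
      case 5
      then show ?thesis using right[of c1 y c2] P[OF C(2)] c by (simp add: b_def I_def)
    next
      case 6
      then show ?thesis using Z(3) by (simp add: b_def I_def)
    qed
  next
    fix i j i' j' :: nat
    assume ij: "i < j" "j < 4" "i' < j'" "j' < 4" "(i, j) \<noteq> (i', j')"
    have dd: "set a1 \<inter> set a2 = {}" "set c1 \<inter> set c2 = {}" "set a1 \<inter> set c1 = {}" "set a1 \<inter> set c2 = {}"
      "set a2 \<inter> set c1 = {}" "set a2 \<inter> set c2 = {}" "Y \<inter> set a1 = {}" "Y \<inter> set a2 = {}"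
      "Y \<inter> set c1 = {}" "Y \<inter> set c2 = {}"
      using sub cdj dist by auto
    note p = pairs_less_4[OF ij(1,2)] pairs_less_4[OF ij(3,4)]
    show "I i j \<inter> I i' j' = {}"
      using p ij(5)
      by (elim insertE emptyE)
        (simp_all add: I_def dd Zd dd[THEN trans[OF Int_commute]] Zd(1,2,4,5,7)[THEN trans[OF Int_commute]])
  qed
  then show False using assms by blast
qed

section \<open>The lower bound graphs\<close>

definition vx :: "nat list \<Rightarrow> nat \<Rightarrow> nat" where
  "vx l q = prod_encode (list_encode l, q)"

lemma vx_eq [simp]: "vx l q = vx l' q' \<longleftrightarrow> l = l' \<and> q = q'"
  by (simp add: vx_def list_encode_eq)

text \<open>Tree nodes are the words \<open>l\<close> over \<open>{..<n}\<close>, encoded as \<open>vx l 0\<close>; the path of a leaf \<open>l\<close> is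
  \<open>vx l 0, \<dots>, vx l L\<close>. For \<open>d > 0\<close> the root \<open>vx [] 0\<close> is isolated; for \<open>d = 0\<close> it starts the
  only path.\<close>
inductive arc :: "nat \<Rightarrow> nat \<Rightarrow> nat \<Rightarrow> nat \<Rightarrow> nat \<Rightarrow> bool" for d n L where
  chain: "length l \<le> d \<Longrightarrow> set l \<subseteq> {..<n} \<Longrightarrow> 0 < j \<Longrightarrow> j < length l \<Longrightarrow>
    arc d n L (vx l 0) (vx (take j l) 0)"
| path: "length l = d \<Longrightarrow> set l \<subseteq> {..<n} \<Longrightarrow> q < L \<Longrightarrow> arc d n L (vx l (Suc q)) (vx l q)"
| rung: "length l = d \<Longrightarrow> set l \<subseteq> {..<n} \<Longrightarrow> q < L \<Longrightarrow> j = q mod Suc d \<Longrightarrow> 0 < j \<Longrightarrow>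
    arc d n L (vx l (Suc q)) (vx (take j l) 0)"

definition comb_V :: "nat \<Rightarrow> nat \<Rightarrow> nat \<Rightarrow> nat set" where
  "comb_V d n L = {vx l 0 | l. length l \<le> d \<and> set l \<subseteq> {..<n}} \<union>
     {vx l q | l q. length l = d \<and> set l \<subseteq> {..<n} \<and> q \<le> L}"

definition comb_E :: "nat \<Rightarrow> nat \<Rightarrow> nat \<Rightarrow> nat set set" where
  "comb_E d n L = {{u, v} | u v. arc d n L u v}"

lemma comb_E_iff: "{u, v} \<in> comb_E d n L \<longleftrightarrow> arc d n L u v \<or> arc d n L v u"
  by (auto simp: comb_E_def doubleton_eq_iff)

lemma set_take_lessThan: "set l \<subseteq> {..<n} \<Longrightarrow> set (take j l) \<subseteq> {..<n :: nat}"
  by (meson order_trans set_take_subset)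

lemma vx_in_comb_V:
  "vx l q \<in> comb_V d n L \<longleftrightarrow> set l \<subseteq> {..<n} \<and> (q = 0 \<and> length l \<le> d \<or> length l = d \<and> q \<le> L)"
  by (auto simp: comb_V_def)

lemma comb_VE:
  assumes "v \<in> comb_V d n L"
  obtains l q where "v = vx l q" "set l \<subseteq> {..<n}" "q = 0 \<and> length l \<le> d \<or> length l = d \<and> q \<le> L"
  using assms by (auto simp: comb_V_def)

lemma arc_in: "arc d n L u v \<Longrightarrow> u \<noteq> v \<and> u \<in> comb_V d n L \<and> v \<in> comb_V d n L"
proof (induction rule: arc.induct)
  case (chain l j)
  then have "take j l \<noteq> l" by (metis length_take min.absorb4 nat_neq_iff)
  then have "l \<noteq> take j l" by metis
  then show ?case using chain set_take_lessThan[of l n j] by (auto simp: vx_in_comb_V)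
qed (use set_take_lessThan in \<open>auto simp: vx_in_comb_V\<close>)

lemma graph_comb: "graph (comb_V d n L) (comb_E d n L)"
proof -
  have "comb_V d n L \<subseteq> (\<lambda>(l, q). vx l q) ` ({l. set l \<subseteq> {..<n} \<and> length l \<le> d} \<times> {..L})"
    by (auto simp: comb_V_def)
  moreover have "finite ({l. set l \<subseteq> {..<n} \<and> length l \<le> d} \<times> {..L})"
    by (simp add: finite_lists_length_le)
  ultimately have "finite (comb_V d n L)" by (meson finite_imageI finite_subset)
  then show ?thesis using arc_in unfolding graph_def comb_E_def by blast
qed

text \<open>The elimination order is word length plus position. A path vertex gets as earlier
  neighbours its predecessor and all \<open>d\<close> nonempty prefixes, not just the one on its
  rung; this makes the sets cliques and gives \<open>d + 1\<close>.\<close>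

lemma treewidth_comb: "treewidth (comb_V d n L) (comb_E d n L) \<le> d + 1"
proof -
  \<comment> \<open>\<open>dec\<close> inverts \<open>vx\<close>, so that \<open>K\<close> and
    \<open>rk\<close> can be defined on numbers.\<close>
  define dec where "dec v = (list_decode (fst (prod_decode v)), snd (prod_decode v))" for v
  define K where "K v = (case dec v of (l, q) \<Rightarrow>
    case q of 0 \<Rightarrow> (\<lambda>j. vx (take j l) 0) ` {0<..<length l}
    | Suc q' \<Rightarrow> insert (vx l q') ((\<lambda>j. vx (take j l) 0) ` {0<..length l}))" for v
  define rk where "rk v = (case dec v of (l, q) \<Rightarrow> length l + q)" for v
  have dec: "dec (vx l q) = (l, q)" for l q by (simp add: dec_def vx_def)
  have K0: "K (vx l 0) = (\<lambda>j. vx (take j l) 0) ` {0<..<length l}" for l by (simp add: K_def dec)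
  have KS: "K (vx l (Suc q)) = insert (vx l q) ((\<lambda>j. vx (take j l) 0) ` {0<..length l})" for l q
    by (simp add: K_def dec)
  have rk: "rk (vx l q) = length l + q" for l q by (simp add: rk_def dec)
  have chain: "vx (take i l) 0 \<in> K (vx (take j l) 0)" if "0 < i" "i < j" "j \<le> length l" for i j l
    using that by (auto simp: K0 intro!: image_eqI[of _ _ i])
  show ?thesis
  proof (rule treewidth_le_chordal[OF graph_comb, where K = K and rk = rk])
    fix v assume "v \<in> comb_V d n L"
    then obtain l q where v: "v = vx l q" "set l \<subseteq> {..<n}" "q = 0 \<and> length l \<le> d \<or> length l = d \<and> q \<le> L"
      by (rule comb_VE)
    show "K v \<subseteq> comb_V d n L"
    proof (cases q)
      case 0
      then show ?thesis using v set_take_lessThan[of l n] by (auto simp: K0 vx_in_comb_V)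
    next
      case (Suc q')
      then show ?thesis using v set_take_lessThan[of l n] by (auto simp: KS vx_in_comb_V)
    qed
    show "card (K v) \<le> d + 1"
    proof (cases q)
      case 0
      have "card (K v) \<le> card {0<..<length l}" unfolding v 0 K0 by (rule card_image_le) simp
      then show ?thesis using v by auto
    next
      case (Suc q')
      have "card (K v) \<le> Suc (card ((\<lambda>j. vx (take j l) 0) ` {0<..length l}))"
        unfolding v Suc KS by (intro card_insert_le_m1) auto
      also have "\<dots> \<le> Suc (card {0<..length l})" using card_image_le by blast
      finally show ?thesis using v by auto
    qed
    show "rk u < rk v" if "u \<in> K v" for u
      using that v by (cases q) (auto simp: K0 KS rk)
    show "u \<in> K u' \<or> u' \<in> K u" if u: "u \<in> K v" "u' \<in> K v" "u \<noteq> u'" for u u'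
    proof -
      have two: "?thesis" if "u = vx (take i l) 0" "0 < i" "i \<le> length l" "u' = vx (take j l) 0" "0 < j" "j \<le> length l" for i j
      proof (cases i j rule: linorder_cases)
        case less
        then show ?thesis using chain that by blast
      next
        case equal
        then show ?thesis using that u(3) by simp
      next
        case greater
        then show ?thesis using chain that by blast
      qed
      have last: "vx (take i l) 0 = vx l q' \<or> vx (take i l) 0 \<in> K (vx l q')" if "0 < i" "i \<le> length l" for i q'
      proof (cases q')
        case 0
        then show ?thesis using that by (cases "i = length l") (auto simp: K0)
      next
        case (Suc q'')
        then show ?thesis using that by (auto simp: KS)
      qed
      show ?thesis
      proof (cases q)
        case 0
        then obtain i j where "u = vx (take i l) 0" "0 < i" "i \<le> length l" "u' = vx (take j l) 0" "0 < j" "j \<le> length l"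
          using u(1,2) unfolding v 0 K0 by auto
        then show ?thesis using two by blast
      next
        case (Suc q')
        have c: "w = vx l q' \<or> (\<exists>i. w = vx (take i l) 0 \<and> 0 < i \<and> i \<le> length l)" if "w \<in> K v" for w
          using that unfolding v Suc KS by auto
        from c[OF u(1)] c[OF u(2)] show ?thesis using two last u(3) by metis
      qed
    qed
  next
    fix u v assume "{u, v} \<in> comb_E d n L"
    then have "arc d n L u v \<or> arc d n L v u" by (simp add: comb_E_iff)
    moreover have "y \<in> K x" if "arc d n L x y" for x y
      using that
    proof cases
      case (rung l q j)
      then have "j \<le> length l" using mod_less_divisor[of "Suc d" q] by simp
      then show ?thesis using rung by (auto simp: KS)
    qed (auto simp: K0 KS)
    ultimately show "u \<in> K v \<or> v \<in> K u" by blast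
  qed
qed

text \<open>A subdivision contracts to a complete minor: each path interior is given to the end with
  smaller index, and \<open>clique_minor_bound\<close> applies.\<close>

lemma Kt_top_minor_treewidth:
  assumes gr: "graph V E" and "has_Kt_top_minor t V E"
  shows "t \<le> treewidth V E + 1"
proof -
  obtain b J where b: "inj_on b {..<t}" "b ` {..<t} \<subseteq> V"
    and conn: "\<And>i j. i < t \<Longrightarrow> j < t \<Longrightarrow> i \<noteq> j \<Longrightarrow> reach (insert (b i) (insert (b j) (J i j))) E (b i) (b j)"
    and sym: "\<And>i j. J i j = J j i"
    and bJ: "\<And>i j. i < t \<Longrightarrow> j < t \<Longrightarrow> i \<noteq> j \<Longrightarrow> J i j \<inter> b ` {..<t} = {}"
    and dJ: "\<And>i j i' j'. i < t \<Longrightarrow> j < t \<Longrightarrow> i \<noteq> j \<Longrightarrow> i' < t \<Longrightarrow> j' < t \<Longrightarrow> i' \<noteq> j' \<Longrightarrow> {i, j} \<noteq> {i', j'} \<Longrightarrow>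
      J i j \<inter> J i' j' = {}"
    using assms(2) by (elim has_Kt_top_minorE) (rule that)
  obtain T r par rk bag where "rooted_decomp T r par rk V E bag (treewidth V E)"
    using rooted_decomp_exists[OF gr] by blast
  then interpret rooted_decomp T r par rk V E bag "treewidth V E" .
  \<comment> \<open>\<open>U i j\<close> is the part of the path reached from \<open>b i\<close>
    without using \<open>b j\<close>. Taking only \<open>j > i\<close> in \<open>A i\<close> keeps
    the sets disjoint.\<close>
  define U where "U i j = {z. reach (insert (b i) (J i j)) E (b i) z}" for i j
  define A where "A i = insert (b i) (\<Union>j\<in>{i<..<t}. U i j)" for i
  have UJ: "U i j \<subseteq> insert (b i) (J i j)" for i j
    using reach_in[of "insert (b i) (J i j)" E "b i"] by (auto simp: U_def)
  have bU: "b i \<in> U i j" for i j by (simp add: U_def)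
  have bnJ: "b l \<notin> J i j" if "l < t" "i < t" "j < t" "i \<noteq> j" for l i j
    using bJ[OF that(2-4)] that(1) by auto
  have Acon: "connected_on (A i) E" if "i < t" for i
  proof -
    have "reach (A i) E (b i) z" if z: "z \<in> A i" for z
    proof (cases "z = b i")
      case False
      then obtain j where j: "j \<in> {i<..<t}" "z \<in> U i j" using z by (auto simp: A_def)
      have "reach (U i j) E (b i) z"
        using connected_on_component[of "insert (b i) (J i j)" E "b i"] j(2) bU[of i j]
        by (auto simp: connected_on_reach U_def)
      then show ?thesis by (rule reach_mono) (use j in \<open>auto simp: A_def\<close>)
    qed simp
    then show ?thesis unfolding connected_on_reach by (blast intro: reach_sym reach_trans)
  qed
  \<comment> \<open>\<open>J\<close> is not known to lie in \<open>V\<close>, but a vertex other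
    than \<open>b i\<close> has an edge on its way to \<open>b i\<close>.\<close>
  have AV: "A i \<subseteq> V" if "i < t" for i
  proof
    fix z assume z: "z \<in> A i"
    show "z \<in> V"
    proof (cases "z = b i")
      case True
      then show ?thesis using b(2) that by auto
    next
      case False
      have "b i \<in> A i" by (simp add: A_def)
      then have "reach (A i) E z (b i)" using Acon[OF that] z unfolding connected_on_reach by blast
      then obtain y where "{z, y} \<in> E" using False by (rule reach_first_step)
      then show ?thesis using graph_edge[OF gr] by blast
    qed
  qed
  have disj: "A i \<inter> A j = {}" if ij: "i < j" "j < t" for i j
  proof -
    have "b i \<noteq> b j" using b(1) ij by (auto simp: inj_on_def)
    moreover have "U i k \<inter> U j l = {}" if "i < k" "k < t" "j < l" "l < t" for k l
    proof -
      have "b i \<notin> J j l" "b j \<notin> J i k" using bnJ[of i j l] bnJ[of j i k] ij that by auto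
      moreover have "J i k \<inter> J j l = {}" using dJ[of i k j l] ij that by (auto simp: doubleton_eq_iff)
      ultimately show ?thesis using UJ[of i k] UJ[of j l] \<open>b i \<noteq> b j\<close> by blast
    qed
    moreover have "b j \<notin> U i k" if "i < k" "k < t" for k
      using bnJ[of j i k] UJ[of i k] ij that \<open>b i \<noteq> b j\<close> by auto
    moreover have "b i \<notin> U j l" if "j < l" "l < t" for l
      using bnJ[of i j l] UJ[of j l] ij that \<open>b i \<noteq> b j\<close> by auto
    ultimately show ?thesis by (fastforce simp: A_def)
  qed
  have touch: "\<exists>u\<in>A i. \<exists>v\<in>A j. {u, v} \<in> E" if ij: "i < j" "j < t" for i j
  proof -
    have "b i \<noteq> b j" using b(1) ij by (auto simp: inj_on_def)
    then have "b j \<notin> U i j" using bnJ[of j i j] UJ[of i j] ij by auto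
    then obtain x y where xy: "x \<in> U i j" "y \<notin> U i j" "y \<in> insert (b i) (insert (b j) (J i j))" "{x, y} \<in> E"
      using reach_crossing[OF conn[of i j] bU[of i j]] ij by (metis less_trans nat_neq_iff)
    \<comment> \<open>A vertex of \<open>J i j\<close> adjacent to \<open>U i j\<close> would belong
      to \<open>U i j\<close>, so the crossing edge ends in \<open>b j\<close>.\<close>
    have "y = b j"
    proof (rule ccontr)
      assume "y \<noteq> b j"
      then have "y \<in> insert (b i) (J i j)" using xy(3) by auto
      then have "reach (insert (b i) (J i j)) E x y"
        using xy UJ by (intro reach_edge) auto
      then have "y \<in> U i j" using xy(1) by (auto simp: U_def intro: reach_trans)
      then show False using xy(2) by simp
    qed
    moreover have "x \<in> A i" using xy(1) ij by (auto simp: A_def)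
    moreover have "b j \<in> A j" by (simp add: A_def)
    ultimately show ?thesis using xy(4) by blast
  qed
  have disj': "A i \<inter> A j = {}" if "i < t" "j < t" "i \<noteq> j" for i j
    using disj[of i j] disj[of j i] that by (metis Int_commute nat_neq_iff)
  have ne: "A i \<noteq> {}" for i by (simp add: A_def)
  have inj: "inj_on A {..<t}"
    using disj' ne unfolding inj_on_def by (metis Int_absorb lessThan_iff)
  have "card (A ` {..<t}) \<le> treewidth V E + 1"
  proof (rule clique_minor_bound)
    show "C \<subseteq> V \<and> connected_on C E \<and> C \<noteq> {}" if "C \<in> A ` {..<t}" for C
      using that AV Acon ne by auto
    show "pairwise disjnt (A ` {..<t})"
      using disj' by (auto simp: pairwise_def disjnt_def)
    fix C C' assume "C \<in> A ` {..<t}" "C' \<in> A ` {..<t}" "C \<noteq> C'"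
    then obtain i j where ij: "i < t" "j < t" "i \<noteq> j" "C = A i" "C' = A j" by auto
    then consider "i < j" | "j < i" by linarith
    then show "\<exists>u\<in>C. \<exists>v\<in>C'. {u, v} \<in> E"
    proof cases
      case 1
      then show ?thesis using touch ij by blast
    next
      case 2
      then obtain u v where "u \<in> A j" "v \<in> A i" "{u, v} \<in> E" using touch ij by blast
      then show ?thesis using ij by (metis insert_commute)
    qed
  qed simp
  then show ?thesis using card_image[OF inj] by simp
qed

section \<open>Forcing a complete minor in the quotient\<close>

text \<open>Used to bound the degree by three. For residue \<open>0\<close> the last entry is the
  root, listed although no rung leads there.\<close>

lemma comb_path_degree:
  assumes "{vx l (Suc q), v} \<in> comb_E d n L"
  shows "v \<in> {vx l q, vx l (Suc (Suc q)), vx (take (q mod Suc d) l) 0}"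
  using assms unfolding comb_E_iff by (auto elim: arc.cases)

lemma comb_root_isolated:
  assumes "d > 0"
  shows "{vx [] 0, v} \<notin> comb_E d n L"
proof -
  have "\<not> arc d n L (vx [] 0) v" by (auto elim: arc.cases)
  moreover have "\<not> arc d n L v (vx [] 0)"
    using assms by (auto elim!: arc.cases)
  ultimately show ?thesis by (simp add: comb_E_iff)
qed

text \<open>Path edges keep the word, and all other edges join a word to one of its nonempty
  prefixes. So the words extending \<open>a @ [x]\<close> can be left only through nonempty prefixes
  of \<open>a\<close>.\<close>

lemma comb_separation:
  assumes uv: "{u, v} \<in> comb_E d n L" and u: "u = vx l q" "prefix (a @ [x]) l"
    and v: "\<And>l' q'. v = vx l' q' \<Longrightarrow> \<not> prefix (a @ [x]) l'"
  shows "v \<in> (\<lambda>k. vx (take k a) 0) ` {0<..length a}"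
proof -
  have key: "vx (take j l) 0 \<in> (\<lambda>k. vx (take k a) 0) ` {0<..length a}"
    if j: "0 < j" and np: "\<not> prefix (a @ [x]) (take j l)" for j
  proof -
    obtain l2 where l2: "l = (a @ [x]) @ l2" using u(2) by (auto simp: prefix_def)
    have "j \<le> length a"
    proof (rule ccontr)
      assume "\<not> j \<le> length a"
      then have "take j l = (a @ [x]) @ take (j - length (a @ [x])) l2"
        unfolding l2 by (subst take_append) simp
      then show False using np by (auto simp: prefix_def)
    qed
    then have "take j l = take j a" by (simp add: l2)
    then show ?thesis using j \<open>j \<le> length a\<close> by auto
  qed
  have up: "prefix (a @ [x]) l'" if "prefix (a @ [x]) (take j l')" for j l'
    using that take_is_prefix prefix_order.trans by blast
  consider "arc d n L u v" | "arc d n L v u" using uv by (auto simp: comb_E_iff)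
  then show ?thesis
  proof cases
    case 1
    then show ?thesis
    proof cases
      case (chain l' j)
      then have "l' = l" using u by simp
      then show ?thesis using key[of j] v chain by simp
    next
      case (path l' q')
      then show ?thesis using u v by auto
    next
      case (rung l' q' j)
      then have "l' = l" using u by simp
      then show ?thesis using key[of j] v rung by simp
    qed
  next
    case 2
    then show ?thesis
    proof cases
      case (chain l' j)
      then have "prefix (a @ [x]) l'" using u up[of j l'] by simp
      then show ?thesis using v chain by blast
    next
      case (path l' q')
      then show ?thesis using u v by auto
    next
      case (rung l' q' j)
      then have "prefix (a @ [x]) l'" using u up[of j l'] by simp
      then show ?thesis using v rung by blast
    qed
  qed
qed

text \<open>Branch vertices have degree at least 4, so they are nonempty words at position
  \<open>0\<close>. Two incomparable words are separated by fewer than \<open>t - 1\<close>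
  vertices, so all branch words form a chain, which has at most \<open>d < t\<close>
  members.\<close>

lemma comb_Kt_free:
  assumes t: "t = d + 1" "t \<ge> 5"
  shows "\<not> has_Kt_top_minor t (comb_V d n L) (comb_E d n L)"
proof
  let ?V = "comb_V d n L" and ?E = "comb_E d n L"
  assume "has_Kt_top_minor t ?V ?E"
  then obtain b J where b: "inj_on b {..<t}" "b ` {..<t} \<subseteq> ?V"
    and conn: "\<And>i j. i < t \<Longrightarrow> j < t \<Longrightarrow> i \<noteq> j \<Longrightarrow> reach (insert (b i) (insert (b j) (J i j))) ?E (b i) (b j)"
    and sym: "\<And>i j. J i j = J j i"
    and bJ: "\<And>i j. i < t \<Longrightarrow> j < t \<Longrightarrow> i \<noteq> j \<Longrightarrow> J i j \<inter> b ` {..<t} = {}"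
    and dJ: "\<And>i j i' j'. i < t \<Longrightarrow> j < t \<Longrightarrow> i \<noteq> j \<Longrightarrow> i' < t \<Longrightarrow> j' < t \<Longrightarrow> i' \<noteq> j' \<Longrightarrow> {i, j} \<noteq> {i', j'} \<Longrightarrow>
      J i j \<inter> J i' j' = {}"
    by (elim has_Kt_top_minorE) (rule that)
  have bnJ: "b l \<notin> J i j" if "l < t" "i < t" "j < t" "i \<noteq> j" for l i j
    using bJ[OF that(2-4)] that(1) by auto
  have bne: "b i \<noteq> b j" if "i < t" "j < t" "i \<noteq> j" for i j
    using b(1) that by (auto simp: inj_on_def)
  have "\<exists>y. {b i, y} \<in> ?E \<and> y \<in> insert (b j) (J i j)" if ij: "i < t" "j < t" "i \<noteq> j" for i j
  proof -
    obtain y where y: "{b i, y} \<in> ?E" "y \<in> insert (b i) (insert (b j) (J i j))"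
      using reach_first_step[OF conn[OF ij] bne[OF ij]] by metis
    moreover have "b i \<noteq> y" using graph_edge[OF graph_comb y(1)] by simp
    ultimately show ?thesis by auto
  qed
  \<comment> \<open>\<open>y i j\<close> is the first vertex after \<open>b i\<close> towards
    \<open>b j\<close>. Different \<open>j\<close> give different vertices, so \<open>b i\<close>
    has \<open>t - 1\<close> neighbours.\<close>
  then obtain y where y: "\<And>i j. i < t \<Longrightarrow> j < t \<Longrightarrow> i \<noteq> j \<Longrightarrow> {b i, y i j} \<in> ?E \<and> y i j \<in> insert (b j) (J i j)"
    by metis
  have y_inj: "inj_on (y i) ({..<t} - {i})" if i: "i < t" for i
  proof (rule inj_onI, rule ccontr)
    fix j k assume jk: "j \<in> {..<t} - {i}" "k \<in> {..<t} - {i}" "y i j = y i k" "j \<noteq> k"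
    then have "J i j \<inter> J i k = {}" using dJ[of i j i k] i by (auto simp: doubleton_eq_iff)
    moreover have "b j \<noteq> b k" "b j \<notin> J i k" "b k \<notin> J i j" using bne bnJ jk i by auto
    ultimately show False using y[of i j] y[of i k] jk i by auto
  qed
  have "\<exists>l. b i = vx l 0 \<and> 0 < length l \<and> length l \<le> d" if i: "i < t" for i
  proof -
    have "b i \<in> ?V" using b(2) i by auto
    then obtain l q where lq: "b i = vx l q" "q = 0 \<and> length l \<le> d \<or> length l = d \<and> q \<le> L"
      by (rule comb_VE) blast
    have "q = 0"
    proof (cases q)
      case (Suc q')
      have "y i ` ({..<t} - {i}) \<subseteq> {vx l q', vx l (Suc (Suc q')), vx (take (q' mod Suc d) l) 0}"
        using y[of i] i comb_path_degree[of l q' _ d n L] lq(1) Suc by auto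
      then have "card (y i ` ({..<t} - {i})) \<le> card {vx l q', vx l (Suc (Suc q')), vx (take (q' mod Suc d) l) 0}"
        by (intro card_mono) auto
      also have "\<dots> \<le> 3" by (simp add: card_insert_if)
      finally show ?thesis using card_image[OF y_inj[OF i]] i t by simp
    qed simp
    moreover have "l \<noteq> []"
    proof
      assume "l = []"
      define j where "j = (if i = 0 then 1 else 0 :: nat)"
      have "j < t" "j \<noteq> i" using t(2) by (auto simp: j_def)
      then have "{vx [] 0, y i j} \<in> ?E" using y[of i j] i lq(1) \<open>q = 0\<close> \<open>l = []\<close> by simp
      then show False using comb_root_isolated[of d] t by auto
    qed
    ultimately show ?thesis using lq by auto
  qed
  then obtain l where l: "\<And>i. i < t \<Longrightarrow> b i = vx (l i) 0 \<and> 0 < length (l i) \<and> length (l i) \<le> d" by metis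
  have comparable: "prefix (l i) (l j) \<or> prefix (l j) (l i)" if ij: "i < t" "j < t" "i \<noteq> j" for i j
  proof (rule ccontr)
    assume "\<not> ?thesis"
    then have "l i \<parallel> l j" by (simp add: parallel_def)
    then obtain a x xs x' xs' where a: "x \<noteq> x'" "l i = a @ x # xs" "l j = a @ x' # xs'"
      using parallel_decomp by metis
    define U where "U = {vx m q | m q. prefix (a @ [x]) m}"
    define Anc where "Anc = (\<lambda>k. vx (take k a) 0) ` {0<..length a}"
    have bi: "b i \<in> U" using l[OF ij(1)] a(2) by (auto simp: U_def prefix_def)
    have bj: "b j \<notin> U" using l[OF ij(2)] a by (auto simp: U_def prefix_def)
    have "length (take k a) < length (l j)" for k using a(3) by simp
    then have "l j \<noteq> take k a" for k by (metis less_irrefl)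
    then have bjA: "b j \<notin> Anc" using l[OF ij(2)] by (auto simp: Anc_def)
    have "\<not> prefix (a @ [x]) (take k a)" for k
      using prefix_length_le[of "a @ [x]" "take k a"] by auto
    then have AncU: "Anc \<inter> U = {}" by (auto simp: Anc_def U_def)
    \<comment> \<open>The \<open>t - 1\<close> disjoint routes from \<open>b i\<close> to
      \<open>b j\<close>: the direct path for \<open>k = j\<close>, otherwise the detour through
      \<open>b k\<close>. Each must use a vertex of \<open>Anc\<close>, but there are at most
      \<open>length a < d\<close> of those.\<close>
    define S where "S k = (if k = j then J i j else insert (b k) (J i k \<union> J k j))" for k
    have "\<exists>v. v \<in> Anc \<and> v \<in> S k" if k: "k < t" "k \<noteq> i" for k
    proof -
      have "reach (insert (b i) (insert (b j) (S k))) ?E (b i) (b j)"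
      proof (cases "k = j")
        case True
        then show ?thesis using conn[OF ij] by (simp add: S_def)
      next
        case False
        have "reach (insert (b i) (insert (b j) (S k))) ?E (b i) (b k)"
          by (rule reach_mono[OF conn[OF ij(1) k(1)]]) (use k False in \<open>auto simp: S_def\<close>)
        moreover have "reach (insert (b i) (insert (b j) (S k))) ?E (b k) (b j)"
          by (rule reach_mono[OF conn[OF k(1) ij(2) False]]) (use False in \<open>auto simp: S_def\<close>)
        ultimately show ?thesis by (rule reach_trans)
      qed
      then obtain u v where uv: "u \<in> U" "v \<notin> U" "v \<in> insert (b i) (insert (b j) (S k))" "{u, v} \<in> ?E"
        using bi bj by (rule reach_crossing)
      obtain m q where "u = vx m q" "prefix (a @ [x]) m" using uv(1) by (auto simp: U_def)
      then have "v \<in> Anc" unfolding Anc_def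
        using uv(2) by (intro comb_separation[OF uv(4)]) (auto simp: U_def)
      moreover from this have "v \<noteq> b j" "v \<noteq> b i" using bjA AncU bi by auto
      ultimately show ?thesis using uv(3) by blast
    qed
    then obtain f where f: "\<And>k. k < t \<Longrightarrow> k \<noteq> i \<Longrightarrow> f k \<in> Anc \<and> f k \<in> S k" by metis
    have "S k \<inter> S k' = {}" if k: "k < t" "k \<noteq> i" "k' < t" "k' \<noteq> i" "k \<noteq> k'" for k k'
    proof -
      have j1: "J i j \<inter> insert (b m) (J i m \<union> J m j) = {}" if "m < t" "m \<noteq> i" "m \<noteq> j" for m
        using dJ[of i j i m] dJ[of i j m j] bnJ[of m i j] ij that by (auto simp: doubleton_eq_iff)
      show ?thesis
      proof (cases "k = j \<or> k' = j")
        case True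
        then show ?thesis using j1[of k] j1[of k'] k by (auto simp: S_def)
      next
        case False
        have "J i k \<inter> J i k' = {}" "J i k \<inter> J k' j = {}" "J k j \<inter> J i k' = {}" "J k j \<inter> J k' j = {}"
          using dJ[of i k i k'] dJ[of i k k' j] dJ[of k j i k'] dJ[of k j k' j] k ij False
          by (auto simp: doubleton_eq_iff)
        moreover have "b k \<notin> J i k'" "b k \<notin> J k' j" "b k' \<notin> J i k" "b k' \<notin> J k j" "b k \<noteq> b k'"
          using bnJ bne k ij False by auto
        ultimately show ?thesis using False by (auto simp: S_def)
      qed
    qed
    then have "inj_on f ({..<t} - {i})" using f unfolding inj_on_def by (metis DiffE disjoint_iff lessThan_iff singletonI)
    moreover have "f ` ({..<t} - {i}) \<subseteq> Anc" using f by auto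
    moreover have "finite Anc" by (simp add: Anc_def)
    ultimately have "card ({..<t} - {i}) \<le> card Anc" by (metis card_inj_on_le)
    also have "\<dots> \<le> length a" unfolding Anc_def using card_image_le[of "{0<..length a}"] by fastforce
    also have "\<dots> < length (l i)" using a by simp
    finally show False using l[OF ij(1)] ij(1) t by simp
  qed
  \<comment> \<open>Comparable words of equal length coincide, so \<open>d + 1\<close> different
    lengths would have to fit between \<open>1\<close> and \<open>d\<close>.\<close>
  have "inj_on (\<lambda>i. length (l i)) {..<t}"
  proof (rule inj_onI, rule ccontr)
    fix i j assume ij: "i \<in> {..<t}" "j \<in> {..<t}" "length (l i) = length (l j)" "i \<noteq> j"
    then have "l i = l j" using comparable[of i j] by (auto simp: prefix_def)
    then show False using bne[of i j] l ij by auto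
  qed
  moreover have "(\<lambda>i. length (l i)) ` {..<t} \<subseteq> {0<..d}" using l by auto
  ultimately have "card {..<t} \<le> card {0<..d}" by (metis card_inj_on_le finite_greaterThanAtMost)
  then show False using t by simp
qed

section \<open>Quotients of comb graphs\<close>

lemma image_connected:
  assumes "connected_on S E" and "\<And>u v. {u, v} \<in> E \<Longrightarrow> p u = p v \<or> {p u, p v} \<in> F"
  shows "connected_on (p ` S) F"
proof -
  have "reach (p ` S) F (p u) (p v)" if "reach S E u v" for u v
    using that unfolding reach_def[of S]
  proof (induction rule: rtranclp_induct)
    case (step x y)
    then have "reach (p ` S) F (p x) (p y)" using assms(2)[of x y] by (auto intro: reach_edge)
    then show ?case using step.IH by (blast intro: reach_trans)
  qed simp
  then show ?thesis using assms(1) by (auto simp: connected_on_reach)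
qed

lemma segment_connected:
  assumes "length l = d" "set l \<subseteq> {..<n}" "e \<le> L"
  shows "connected_on (vx l ` {a..e}) (comb_E d n L)"
proof -
  have "reach (vx l ` {a..e}) (comb_E d n L) (vx l a) (vx l q)" if "a \<le> q" "q \<le> e" for q
    using that
  proof (induction q rule: dec_induct)
    case (step q)
    then have "arc d n L (vx l (Suc q)) (vx l q)" using assms by (intro arc.path) auto
    then have "{vx l q, vx l (Suc q)} \<in> comb_E d n L" by (simp add: comb_E_iff)
    then have "reach (vx l ` {a..e}) (comb_E d n L) (vx l q) (vx l (Suc q))"
      using step by (intro reach_edge) auto
    then show ?case using step by (auto intro: reach_trans)
  qed simp
  then have "reach (vx l ` {a..e}) (comb_E d n L) (vx l u) (vx l v)"
    if "u \<in> {a..e}" "v \<in> {a..e}" for u v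
    using that by (meson atLeastAtMost_iff reach_sym reach_trans)
  then show ?thesis unfolding connected_on_reach by blast
qed

text \<open>Fewer than \<open>N\<close> bad numbers cannot touch all of the first \<open>N\<close>
  blocks of length \<open>s\<close>.\<close>

lemma div_avoid:
  assumes "finite A" "card A < N" "s > 0"
  obtains R where "R < N" "\<And>q :: nat. q \<in> A \<Longrightarrow> q div s \<noteq> R"
proof -
  have "card ((\<lambda>q. q div s) ` A) < card {..<N}"
    using card_image_le[OF assms(1), of "\<lambda>q. q div s"] assms(2) by simp
  then have "\<not> {..<N} \<subseteq> (\<lambda>q. q div s) ` A" using card_mono[of "(\<lambda>q. q div s) ` A" "{..<N}"] assms(1) by fastforce
  then show ?thesis using that by blast
qed

text \<open>A branch with prefixes in \<open>d\<close> different parts is found first. Then a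
  stretch of its path avoiding these parts is split into two disjoint connected sets of parts, each
  touching all of them.\<close>

lemma treewidth_comb_partition:
  assumes gH: "graph H F" and hp: "H_partition_width_le (comb_V d n L) (comb_E d n L) H F p w"
    and n: "n > d * w" and L: "L = (d * w + 1) * ((d + 1) * w + 2) * (d + 1)"
  shows "d + 1 \<le> treewidth H F"
proof -
  let ?V = "comb_V d n L" and ?E = "comb_E d n L"
  define m where "m = d + 1"
  define s where "s = m * w + 2"
  have L': "L = (d * w + 1) * (s * m)" using L unfolding m_def s_def mult.assoc .
  have pH: "\<And>v. v \<in> ?V \<Longrightarrow> p v \<in> H" and pE: "\<And>u v. {u, v} \<in> ?E \<Longrightarrow> p u = p v \<or> {p u, p v} \<in> F"
    and pw: "\<And>x. x \<in> H \<Longrightarrow> card {v \<in> ?V. p v = x} \<le> w"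
    using hp by (auto simp: H_partition_width_le_def)
  have finV: "finite ?V" using graph_comb by (simp add: graph_def)
  have parts: "card {v \<in> ?V. p v \<in> S} \<le> card S * w" if "finite S" for S
  proof -
    have "card {v \<in> ?V. p v = x} \<le> w" for x
    proof (cases "x \<in> H")
      case False
      then have "{v \<in> ?V. p v = x} = {}" using pH by auto
      then show ?thesis by (metis card.empty zero_le)
    qed (rule pw)
    moreover have "{v \<in> ?V. p v \<in> S} = (\<Union>x\<in>S. {v \<in> ?V. p v = x})" by auto
    ultimately show ?thesis
      using card_UN_le[OF that, of "\<lambda>x. {v \<in> ?V. p v = x}"] sum_bounded_above[of S "\<lambda>x. card {v \<in> ?V. p v = x}" w]
      by simp
  qed
  have hit: "card A \<le> card S * w"
    if "finite S" "inj_on g A" "\<And>a. a \<in> A \<Longrightarrow> g a \<in> ?V \<and> p (g a) \<in> S" for A :: "nat set" and g S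
  proof -
    have "card A \<le> card {v \<in> ?V. p v \<in> S}"
      by (rule card_inj_on_le[OF that(2)]) (use that(3) finV in auto)
    then show ?thesis using parts[OF that(1)] by simp
  qed
  \<comment> \<open>The branch grows letter by letter: at most \<open>d * w\<close> of the
    \<open>n\<close> children lie in parts already used by the prefixes.\<close>
  have "\<exists>l. length l = j \<and> set l \<subseteq> {..<n} \<and> inj_on (\<lambda>i. p (vx (take i l) 0)) {0<..j}" if "j \<le> d" for j
    using that
  proof (induction j)
    case (Suc j)
    then obtain l where l: "length l = j" "set l \<subseteq> {..<n}" "inj_on (\<lambda>i. p (vx (take i l) 0)) {0<..j}"
      by auto
    define S where "S = (\<lambda>i. p (vx (take i l) 0)) ` {0<..j}"
    have "\<exists>a<n. p (vx (l @ [a]) 0) \<notin> S"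
    proof (rule ccontr)
      assume "\<not> ?thesis"
      then have all: "\<And>a. a < n \<Longrightarrow> p (vx (l @ [a]) 0) \<in> S" by blast
      have "card {..<n} \<le> card S * w"
        by (rule hit[where g = "\<lambda>a. vx (l @ [a]) 0"])
          (use all l Suc.prems in \<open>auto simp: S_def inj_on_def vx_in_comb_V\<close>)
      also have "card S \<le> j" unfolding S_def using card_image_le[of "{0<..j}"] by fastforce
      then have "card S * w \<le> d * w" using Suc.prems by (intro mult_le_mono1) simp
      finally show False using n by simp
    qed
    then obtain a where a: "a < n" "p (vx (l @ [a]) 0) \<notin> S" by blast
    have "inj_on (\<lambda>i. p (vx (take i (l @ [a])) 0)) {0<..Suc j}"
    proof -
      have eq: "{0<..Suc j} = insert (Suc j) {0<..j}" by auto
      have img: "(\<lambda>i. p (vx (take i (l @ [a])) 0)) ` {0<..j} = S"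
        unfolding S_def using l(1) by (intro image_cong) auto
      have "inj_on (\<lambda>i. p (vx (take i (l @ [a])) 0)) {0<..j}"
        using l(3) by (rule inj_on_cong[THEN iffD1, rotated]) (use l(1) in auto)
      moreover have "p (vx (take (Suc j) (l @ [a])) 0) \<notin> S" using a(2) l(1) by simp
      ultimately show ?thesis unfolding eq inj_on_insert using img by auto
    qed
    then show ?case using l a by (intro exI[of _ "l @ [a]"]) auto
  qed auto
  then obtain l where l: "length l = d" "set l \<subseteq> {..<n}" "inj_on (\<lambda>i. p (vx (take i l) 0)) {0<..d}"
    by blast
  define B where "B i = p (vx (take i l) 0)" for i
  define U where "U = B ` {0<..d}"
  \<comment> \<open>The shift by \<open>Suc\<close> matches \<open>rung\<close>, where vertex
    \<open>Suc q\<close> is attached according to the residue of \<open>q\<close>.\<close>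
  define \<phi> where "\<phi> q = p (vx l (Suc q))" for q
  have vxV: "vx l q \<in> ?V" if "q \<le> L" for q using that l by (simp add: vx_in_comb_V)
  have vtV: "vx (take i l) 0 \<in> ?V" for i using l set_take_lessThan[of l n i] by (simp add: vx_in_comb_V)
  have m0: "m > 0" "s * m > 0" by (simp_all add: m_def s_def)
  have cU: "finite U" "card U \<le> d" unfolding U_def using card_image_le[of "{0<..d}" B] by auto
  have hit\<phi>: "card {q. q < L \<and> \<phi> q \<in> S} \<le> card S * w" if "finite S" for S
    by (rule hit[OF that, where g = "\<lambda>q. vx l (Suc q)"]) (auto simp: inj_on_def \<phi>_def vxV)
  \<comment> \<open>At most \<open>d * w\<close> positions fall into parts of \<open>U\<close>, so
    one of the \<open>d * w + 1\<close> blocks of length \<open>s * m\<close> avoids them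
    all.\<close>
  have "card {q. q < L \<and> \<phi> q \<in> U} < d * w + 1"
    using order_trans[OF hit\<phi>[OF cU(1)] mult_le_mono1[OF cU(2)]] by simp
  then obtain R where R: "R < d * w + 1" "\<And>q. q \<in> {q. q < L \<and> \<phi> q \<in> U} \<Longrightarrow> q div (s * m) \<noteq> R"
    using div_avoid[of "{q. q < L \<and> \<phi> q \<in> U}" "d * w + 1" "s * m"] m0 by auto
  define a where "a = R * (s * m)"
  have aL: "a + s * m \<le> L"
  proof -
    have "a + s * m = Suc R * (s * m)" by (simp add: a_def)
    also have "\<dots> \<le> L" unfolding L' using R(1) by (intro mult_le_mono1) simp
    finally show ?thesis .
  qed
  have noU: "\<phi> q \<notin> U" if "a \<le> q" "q < a + s * m" for q
  proof
    assume "\<phi> q \<in> U"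
    then have "q div (s * m) \<noteq> R" using R(2) that aL by auto
    moreover have "q div (s * m) = R"
      using that m0(2) by (intro div_nat_eqI) (auto simp: a_def mult.commute)
    ultimately show False by simp
  qed
  define Pf where "Pf = \<phi> ` {a..<a + m}"
  have cPf: "finite Pf" "card Pf \<le> m" unfolding Pf_def using card_image_le[of "{a..<a+m}" \<phi>] by auto
  \<comment> \<open>Positions counted from the end of the first \<open>m\<close> ones of the block.
    Truncated subtraction sends earlier ones to \<open>0\<close>, which does not raise the count; it
    stays below the number \<open>s - 1\<close> of remaining windows, so some window avoids
    \<open>Pf\<close>.\<close>
  define A2 where "A2 = (\<lambda>q. q - (a + m)) ` {q. q < L \<and> \<phi> q \<in> Pf}"
  have "card A2 \<le> card {q. q < L \<and> \<phi> q \<in> Pf}" unfolding A2_def by (rule card_image_le) auto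
  also have "\<dots> \<le> m * w" by (rule order_trans[OF hit\<phi>[OF cPf(1)] mult_le_mono1[OF cPf(2)]])
  finally have "card A2 < s - 1" by (simp add: s_def)
  moreover have "finite A2" by (simp add: A2_def)
  ultimately obtain g where g: "g < s - 1" "\<And>q. q \<in> A2 \<Longrightarrow> q div m \<noteq> g"
    using div_avoid[of A2 "s - 1" m] m0 by auto
  define c where "c = a + m + g * m"
  have cL: "c + m \<le> a + s * m"
  proof -
    have "c + m = a + (g + 2) * m" by (simp add: c_def algebra_simps)
    also have "\<dots> \<le> a + s * m" using g(1) by (intro add_left_mono mult_le_mono1) simp
    finally show ?thesis .
  qed
  have noPf: "\<phi> q \<notin> Pf" if "c \<le> q" "q < c + m" for q
  proof
    assume "\<phi> q \<in> Pf"
    then have "q - (a + m) \<in> A2" using that cL aL by (auto simp: A2_def)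
    then have "(q - (a + m)) div m \<noteq> g" by (rule g(2))
    moreover have "(q - (a + m)) div m = g"
      using that m0(1) by (intro div_nat_eqI) (auto simp: c_def mult.commute)
    ultimately show False by simp
  qed
  \<comment> \<open>\<open>q0\<close> is the last position before the good window \<open>c\<close>
    that returns to a part of \<open>Pf\<close>. From there on the path stays off \<open>Pf\<close>,
    so its image \<open>Tl\<close> is disjoint from \<open>Pf\<close> yet adjacent to it.\<close>
  define Q where "Q = {q. a \<le> q \<and> q < c \<and> \<phi> q \<in> Pf}"
  have "finite Q" by (rule finite_subset[of _ "{..c}"]) (auto simp: Q_def)
  moreover have "a \<in> Q" using m0 by (auto simp: Q_def c_def Pf_def)
  ultimately obtain q0 where q0: "q0 \<in> Q" "\<And>q. q \<in> Q \<Longrightarrow> q \<le> q0"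
    using ex_max_nat[of Q "\<lambda>q. q"] by blast
  define Tl where "Tl = \<phi> ` {q0<..<c + m}"
  have q0c: "a \<le> q0" "q0 < c" "\<phi> q0 \<in> Pf" using q0(1) by (auto simp: Q_def)
  have tl: "\<phi> q \<notin> Pf" if "q0 < q" "q < c + m" for q
    using noPf[of q] q0(2)[of q] q0c that by (cases "q < c") (auto simp: Q_def)
  have phi_image: "\<phi> ` X = p ` vx l ` Suc ` X" for X by (simp add: \<phi>_def image_image)
  have Pf_con: "connected_on Pf F"
  proof -
    have "Suc ` {a..<a + m} = {Suc a..a + m}" by (auto simp: image_Suc_atLeastLessThan)
    moreover have "connected_on (vx l ` {Suc a..a + m}) ?E"
      using l aL cL by (intro segment_connected) (auto simp: c_def)
    ultimately show ?thesis unfolding Pf_def phi_image using image_connected[OF _ pE] by simp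
  qed
  have Tl_con: "connected_on Tl F"
  proof -
    have "Suc ` {q0<..<c + m} = {Suc (Suc q0)..c + m}"
      by (metis atLeastLessThanSuc_atLeastAtMost atLeastSucLessThan_greaterThanLessThan image_Suc_atLeastLessThan)
    moreover have "connected_on (vx l ` {Suc (Suc q0)..c + m}) ?E"
      using l aL cL by (intro segment_connected) auto
    ultimately show ?thesis unfolding Tl_def phi_image using image_connected[OF _ pE] by simp
  qed
  have inV: "Pf \<subseteq> H" "Tl \<subseteq> H" "U \<subseteq> H"
    using pH vxV vtV aL cL by (auto simp: Pf_def Tl_def U_def B_def \<phi>_def c_def)
  have dPT: "Pf \<inter> Tl = {}" using tl by (auto simp: Tl_def)
  have dU: "Pf \<inter> U = {}" "Tl \<inter> U = {}"
    using noU cL q0c by (auto simp: Pf_def Tl_def c_def)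
  \<comment> \<open>A window of length \<open>m = d + 1\<close> starting at a multiple of
    \<open>m\<close> has every residue, hence a rung to each nonempty prefix.\<close>
  have rungs: "\<exists>v\<in>\<phi> ` {k..<k + m}. {B i, v} \<in> F"
    if i: "0 < i" "i \<le> d" and k: "m dvd k" "k + m \<le> L" and dis: "\<phi> ` {k..<k + m} \<inter> U = {}" for i k
  proof -
    have im: "i < m" using i by (simp add: m_def)
    have "(k + i) mod m = i" using k(1) im by (auto elim!: dvdE)
    then have "i = (k + i) mod Suc d" by (simp add: m_def)
    moreover have "k + i < L" using k(2) im by linarith
    ultimately have "arc d n L (vx l (Suc (k + i))) (vx (take i l) 0)"
      using arc.rung[OF l(1,2)] i(1) by blast
    then have "{vx (take i l) 0, vx l (Suc (k + i))} \<in> ?E" by (simp add: comb_E_iff)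
    then have "B i = \<phi> (k + i) \<or> {B i, \<phi> (k + i)} \<in> F" using pE by (simp add: B_def \<phi>_def)
    moreover have "\<phi> (k + i) \<in> \<phi> ` {k..<k + m}" using im by auto
    moreover have "B i \<in> U" using i by (auto simp: U_def)
    ultimately show ?thesis using dis by (metis disjoint_iff)
  qed
  \<comment> \<open>The complete minor of \<open>H\<close>: two sets from the path and
    \<open>d\<close> single parts.\<close>
  define \<F> where "\<F> = insert Pf (insert Tl ((\<lambda>x. {x}) ` U))"
  have "Suc q0 \<in> {q0<..<c + m}" using m0 q0c by auto
  then have ne: "Pf \<noteq> {}" "Tl \<noteq> {}" using q0c unfolding Tl_def by blast+
  have "card U = d" unfolding U_def using card_image[of B "{0<..d}"] l(3) by (simp add: B_def[abs_def])
  then have cI: "card ((\<lambda>x. {x}) ` U) = d" by (simp add: card_image)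
  have "Pf \<notin> (\<lambda>x. {x}) ` U" "Tl \<notin> (\<lambda>x. {x}) ` U" "Pf \<noteq> Tl" using dU dPT ne by auto
  then have cF: "card \<F> = d + 2" using cI cU(1) by (simp add: \<F>_def)
  obtain T r par rk bag where "rooted_decomp T r par rk H F bag (treewidth H F)"
    using rooted_decomp_exists[OF gH] by blast
  then interpret rooted_decomp T r par rk H F bag "treewidth H F" .
  have PT: "\<exists>u\<in>Pf. \<exists>v\<in>Tl. {u, v} \<in> F"
  proof -
    have "Suc q0 < L" using q0c(2) cL aL m0(1) by linarith
    then have "arc d n L (vx l (Suc (Suc q0))) (vx l (Suc q0))"
      using l by (intro arc.path)
    then have "{vx l (Suc q0), vx l (Suc (Suc q0))} \<in> ?E" by (simp add: comb_E_iff)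
    then have "\<phi> q0 = \<phi> (Suc q0) \<or> {\<phi> q0, \<phi> (Suc q0)} \<in> F" using pE by (simp add: \<phi>_def)
    moreover have "\<phi> (Suc q0) \<in> Tl" using q0c m0 by (auto simp: Tl_def)
    ultimately show ?thesis using q0c dPT by (metis disjoint_iff)
  qed
  have dvd: "m dvd a" "m dvd c" by (auto simp: a_def c_def)
  have UP: "\<exists>v\<in>Pf. {x, v} \<in> F" if "x \<in> U" for x
    using rungs[of _ a] that dvd dU(1) aL cL unfolding U_def Pf_def by (auto simp: c_def)
  have UT: "\<exists>v\<in>Tl. {x, v} \<in> F" if x: "x \<in> U" for x
  proof -
    have sub: "\<phi> ` {c..<c + m} \<subseteq> Tl" using q0c by (auto simp: Tl_def)
    obtain i where "x = B i" "0 < i" "i \<le> d" using x by (auto simp: U_def)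
    then show ?thesis using rungs[of i c] sub dvd dU(2) aL cL by fastforce
  qed
  have UU: "{x, y} \<in> F" if xy: "x \<in> U" "y \<in> U" "x \<noteq> y" for x y
  proof -
    have less: "{B i, B j} \<in> F" if "0 < i" "i < j" "j \<le> d" "B i \<noteq> B j" for i j
    proof -
      have "arc d n L (vx (take j l) 0) (vx (take i (take j l)) 0)"
        using l that set_take_lessThan[of l n j] by (intro arc.chain) auto
      moreover have "take i (take j l) = take i l" using that by simp
      ultimately have "{vx (take i l) 0, vx (take j l) 0} \<in> ?E" by (simp add: comb_E_iff)
      then show ?thesis using pE that(4) by (auto simp: B_def)
    qed
    obtain i j where ij: "x = B i" "y = B j" "0 < i" "i \<le> d" "0 < j" "j \<le> d"
      using xy by (auto simp: U_def)
    then have "i \<noteq> j" using xy by auto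
    then show ?thesis using less[of i j] less[of j i] ij xy(3) by (metis insert_commute nat_neq_iff)
  qed
  have "card \<F> \<le> treewidth H F + 1"
  proof (rule clique_minor_bound)
    show "finite \<F>" using cU by (simp add: \<F>_def)
    show "C \<subseteq> H \<and> connected_on C F \<and> C \<noteq> {}" if "C \<in> \<F>" for C
      using that inV Pf_con Tl_con ne by (auto simp: \<F>_def connected_on_reach)
    show "pairwise disjnt \<F>"
      using dPT dU unfolding \<F>_def pairwise_def disjnt_def by blast
    show "\<exists>u\<in>C. \<exists>v\<in>C'. {u, v} \<in> F" if "C \<in> \<F>" "C' \<in> \<F>" "C \<noteq> C'" for C C'
    proof -
      have sym: "\<exists>u\<in>X. \<exists>v\<in>Y. {u, v} \<in> F" if "\<exists>u\<in>Y. \<exists>v\<in>X. {u, v} \<in> F" for X Y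
        using that by (metis insert_commute)
      have one: "C = Pf \<or> C = Tl \<or> (\<exists>x\<in>U. C = {x})" "C' = Pf \<or> C' = Tl \<or> (\<exists>x\<in>U. C' = {x})"
        using that by (auto simp: \<F>_def)
      have UP': "\<exists>u\<in>{x}. \<exists>v\<in>Pf. {u, v} \<in> F" and UT': "\<exists>u\<in>{x}. \<exists>v\<in>Tl. {u, v} \<in> F" if "x \<in> U" for x
        using UP[OF that] UT[OF that] by auto
      show ?thesis
        using one that(3) PT sym[OF PT] UP' UT' sym[OF UP'] sym[OF UT'] UU by auto
    qed
  qed
  then show ?thesis using cF by simp
qed

text \<open>Putting all vertices into one part shows that the minimum in \<open>tpw\<close> is
  attained.\<close>

lemma ex_H_partition:
  assumes "graph V E"
  shows "\<exists>VH EH p. graph VH EH \<and> treewidth VH EH \<le> c \<and> H_partition_width_le V E VH EH p (tpw c V E)"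
proof -
  have g: "graph {0} {}" by (simp add: graph_def)
  have "treewidth {0} {} \<le> 0"
    by (rule treewidth_le_chordal[OF g, where K = "\<lambda>_. {}" and rk = id]) auto
  moreover have "H_partition_width_le V E {0} {} (\<lambda>_. 0) (card V)"
    by (simp add: H_partition_width_le_def)
  ultimately have "\<exists>w VH EH p. graph VH EH \<and> treewidth VH EH \<le> c \<and> H_partition_width_le V E VH EH p w"
    using g le_trans by blast
  then show ?thesis unfolding tpw_def by (rule LeastI_ex)
qed

text \<open>All combs for a fixed \<open>d\<close> have treewidth at most \<open>d + 1\<close>, so
  \<open>f\<close> would bound their partition width by one constant \<open>w\<close>. Choosing
  \<open>n\<close> and \<open>L\<close> afterwards, large in terms of \<open>w\<close>, contradicts
  this.\<close>

lemma not_bounded_if_combs: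
  assumes "\<And>n L. (comb_V d n L, comb_E d n L) \<in> \<G>" and "c \<le> d"
  shows "\<not> tpw_bounded_by_tw \<G> c"
proof
  assume "tpw_bounded_by_tw \<G> c"
  then obtain f where f: "\<And>V E. (V, E) \<in> \<G> \<Longrightarrow> tpw c V E \<le> f (treewidth V E)"
    unfolding tpw_bounded_by_tw_def by blast
  define w where "w = Max (f ` {..d + 1})"
  define n where "n = d * w + 1"
  define L where "L = (d * w + 1) * ((d + 1) * w + 2) * (d + 1)"
  have "tpw c (comb_V d n L) (comb_E d n L) \<le> f (treewidth (comb_V d n L) (comb_E d n L))"
    by (rule f[OF assms(1)])
  also have "\<dots> \<le> w" unfolding w_def using treewidth_comb by (intro Max_ge) auto
  finally have tpw: "tpw c (comb_V d n L) (comb_E d n L) \<le> w" .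
  obtain H F p where H: "graph H F" "treewidth H F \<le> c"
    "H_partition_width_le (comb_V d n L) (comb_E d n L) H F p (tpw c (comb_V d n L) (comb_E d n L))"
    using ex_H_partition[OF graph_comb] by blast
  have "H_partition_width_le (comb_V d n L) (comb_E d n L) H F p w"
    using H(3) tpw unfolding H_partition_width_le_def by (meson le_trans)
  then have "d + 1 \<le> treewidth H F"
    by (rule treewidth_comb_partition[OF H(1)]) (simp_all add: n_def L_def)
  then show False using H(2) assms(2) by simp
qed

section \<open>Combination of the bounds\<close>

theorem theorem6p2:
  fixes t :: nat
  assumes "t \<ge> 2"
  shows "underlying_treewidth_eq (Kt_top_minor_free_class t)
           (if t \<le> 4 then t - 2 else t)"
proof -
  let ?\<G> = "Kt_top_minor_free_class t"
  have upper: "tpw_bounded_by_tw ?\<G> c"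
    if "b \<ge> 1" "\<And>V E. \<not> has_Kt_top_minor t V E \<Longrightarrow> \<not> has_bundle V E c b" for b c
    by (rule bounded_if_no_bundle[OF that(1)]) (use that(2) in \<open>auto simp: Kt_top_minor_free_class_def\<close>)
  have lower: "\<not> tpw_bounded_by_tw ?\<G> c"
    if "\<And>n L. \<not> has_Kt_top_minor t (comb_V d n L) (comb_E d n L)" "c \<le> d" for c d
    by (rule not_bounded_if_combs[OF _ that(2)])
      (use that(1) graph_comb in \<open>auto simp: Kt_top_minor_free_class_def\<close>)
  \<comment> \<open>With \<open>d = t - 3\<close> the treewidth is at most \<open>t - 2\<close>,
    whereas a subdivided complete graph on \<open>t\<close> vertices needs \<open>t - 1\<close>.
    This excludes every value up to \<open>t - 3\<close>.\<close>
  have small: "\<not> has_Kt_top_minor t (comb_V (t - 3) n L) (comb_E (t - 3) n L)" if "t \<ge> 3" for n L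
    using Kt_top_minor_treewidth[OF graph_comb, of t "t - 3" n L] treewidth_comb[of "t - 3" n L] that by linarith
  consider "t = 2" | "t = 3" | "t = 4" | "t \<ge> 5" using assms by linarith
  then show ?thesis
  proof cases
    case 1
    then show ?thesis using upper[of 2 0] no_bundle_2 by (simp add: underlying_treewidth_eq_def)
  next
    case 2
    then show ?thesis using upper[of 2 1] no_bundle_3 lower[of 0] small
      by (simp add: underlying_treewidth_eq_def)
  next
    case 3
    then show ?thesis using upper[of 3 2] no_bundle_4 lower[of 1] small
      by (simp add: underlying_treewidth_eq_def)
  next
    case 4
    \<comment> \<open>From \<open>t = 5\<close> on, combs with the larger depth
      \<open>d = t - 1\<close> are available and exclude all \<open>c < t\<close>.\<close>
    have "\<not> tpw_bounded_by_tw ?\<G> c" if "c < t" for c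
      by (rule lower[of "t - 1"]) (use comb_Kt_free[of t "t - 1"] 4 that in auto)
    moreover have "tpw_bounded_by_tw ?\<G> t"
      by (rule upper[of "t * t"]) (use no_bundle_general[of t] 4 in auto)
    ultimately show ?thesis using 4 by (simp add: underlying_treewidth_eq_def)
  qed
qed

end
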